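(* Let $\theta_0\in\mathbb{R}$ and let $X_1,\dots,X_n$ be independent (not necessarily identically distributed) real random variables all with median $\theta_0$, i.e. $\mathbb{P}(X_i\le\theta_0)\ge 1/2$ and $\mathbb{P}(X_i\ge\theta_0)\ge 1/2$ for all $i\in\{1,\dots,n\}$. Let $c_{n,\alpha}$ and $\widehat{\mathrm{CI}}_{n,\alpha}$ be as defined in the context. Then: 1. For all $n\ge 1$ and any $\alpha\in(0,1)$, $\mathbb{P}(\theta_0\in\widehat{\mathrm{CI}}_{n,\alpha})\ge 1-\alpha$. 2. For any $\alpha\in(0,1)$, $$\widehat{\mathrm{CI}}_{n,\alpha}=\begin{cases}\left[X_{(\lfloor n/2\rfloor-c_{n,\alpha})},\ X_{(\lceil n/2\rceil+c_{n,\alpha}+1)}\right], & \text{if } n\ge\log_2(2/\alpha),\\ \mathbb{R}, & \text{if } n<\log_2(2/\alpha).\end{cases}$$ 3. For any $\alpha\in(0,1)$, $$c_{n,\alpha}-\frac{\sqrt{n}\,z_{\alpha/2}}{2}\in\begin{cases}\left[-\frac{1}{2\sqrt{n}}\max\left\{\frac{z_{\alpha/2}^3}{5},\ \sqrt{1+\frac{2\ln(2)-1}{n^2}}\right\}-1.5,\ \ 1\right], & \text{if } n\ge\log_2(2/\alpha),\\ \left\{\lfloor n/2\rfloor-\sqrt{n}\,z_{\alpha/2}/2\right\}, & \text{if } n<\log_2(2/\alpha).\end{cases}$$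
   Context: $z_{\alpha/2}$ is the $(1-\alpha/2)$-quantile of the standard normal distribution. $X_{(1)}\le\dots\le X_{(n)}$ are the order statistics of $X_1,\dots,X_n$. With $Y_n\sim\mathrm{Bin}(n,1/2)$, $c_{n,\alpha}$ is the smallest integer $x$ such that $\mathbb{P}(Y_n\ge\lfloor n/2\rfloor-x)\ge 1-\alpha/2$. The confidence set is $\widehat{\mathrm{CI}}_{n,\alpha}=\widehat{\mathrm{CI}}_{1,n,\alpha}\cap\widehat{\mathrm{CI}}_{2,n,\alpha}$, where $$\widehat{\mathrm{CI}}_{1,n,\alpha}=\Big\{\theta\in\mathbb{R}:\sum_{i=1}^n\mathbf{1}\{X_i\le\theta\}\ge\lfloor n/2\rfloor-c_{n,\alpha}\Big\},\quad \widehat{\mathrm{CI}}_{2,n,\alpha}=\Big\{\theta\in\mathbb{R}:\sum_{i=1}^n\mathbf{1}\{X_i\ge\theta\}\ge\lfloor n/2\rfloor-c_{n,\alpha}\Big\}.$$ *)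

theory Defs
  imports "HOL-Probability.Probability"
begin

definition quantile :: "real measure \<Rightarrow> real \<Rightarrow> real" where
  "quantile M p = Inf {x. cdf M x \<ge> p}"

definition z_upper :: "real \<Rightarrow> real" where
  "z_upper \<beta> = quantile std_normal_distribution (1 - \<beta>)"

(* The k-th smallest of x 1, ..., x n; meaningful only for k in {1..n}. *)
definition order_stat :: "nat \<Rightarrow> (nat \<Rightarrow> real) \<Rightarrow> nat \<Rightarrow> real" where
  "order_stat n x k = sort (map x [1..<Suc n]) ! (k - 1)"

(* LEAST over int is well defined here for 0 < \<alpha> < 1: the probability is 0 for
   sufficiently negative x, and it is 1 for x = \<lfloor>n/2\<rfloor>. *)
definition c_crit :: "nat \<Rightarrow> real \<Rightarrow> int" where
  "c_crit n \<alpha> =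
    (LEAST x::int. measure_pmf.prob (binomial_pmf n (1/2)) {y. int y \<ge> \<lfloor>real n / 2\<rfloor> - x} \<ge> 1 - \<alpha> / 2)"

definition CI1 :: "nat \<Rightarrow> real \<Rightarrow> (nat \<Rightarrow> real) \<Rightarrow> real set" where
  "CI1 n \<alpha> x = {\<theta>. (\<Sum>i=1..n. of_bool (x i \<le> \<theta>)) \<ge> \<lfloor>real n / 2\<rfloor> - c_crit n \<alpha>}"

definition CI2 :: "nat \<Rightarrow> real \<Rightarrow> (nat \<Rightarrow> real) \<Rightarrow> real set" where
  "CI2 n \<alpha> x = {\<theta>. (\<Sum>i=1..n. of_bool (x i \<ge> \<theta>)) \<ge> \<lfloor>real n / 2\<rfloor> - c_crit n \<alpha>}"

definition CI :: "nat \<Rightarrow> real \<Rightarrow> (nat \<Rightarrow> real) \<Rightarrow> real set" where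
  "CI n \<alpha> x = CI1 n \<alpha> x \<inter> CI2 n \<alpha> x"

end

theory Submission
  imports Defs
begin

text \<open>
  Coverage: with success probabilities at least \<open>1/2\<close>, the number of \<open>X\<^sub>i \<le> \<theta>\<^sub>0\<close> stochastically
  dominates \<open>Bin(n, 1/2)\<close>, so each of the two one-sided sets misses \<open>\<theta>\<^sub>0\<close> with probability at most
  \<open>\<alpha>/2\<close>.

  Size of \<open>c\<close>: by symmetry \<open>c\<close> is the least \<open>x \<ge> 0\<close> with \<open>P(Y \<ge> \<lceil>n/2\<rceil> + 1 + x) \<le> \<alpha>/2\<close>, and
  \<open>\<alpha>/2\<close> is the normal tail at \<open>z\<close>; both bounds therefore compare binomial with normal tails. For the
  upper bound on \<open>c\<close>, the ratio of a binomial weight to the mass of the corresponding normal cell is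
  decreasing, hence the difference of the tails cannot change sign. For the lower bound on \<open>c\<close>,
  binomial weights are bounded below by \<open>sqrt (2 / (\<pi> N)) exp (- N H(s))\<close> with \<open>N = n + 1\<close>,
  \<open>s = (2 j - n) / N\<close> and \<open>H\<close> the large deviation rate, and \<open>H(s) \<le> (s + s\<^sup>3/5)\<^sup>2/2\<close>. Telescoping the
  normal tail along the points \<open>sqrt N (s + s\<^sup>3/5)\<close> then gives \<open>z \<le> u + u\<^sup>3/(5 n)\<close> for
  \<open>u = (2 j - n) / sqrt n\<close>, whence \<open>z - z\<^sup>3/(5 n) \<le> u\<close>.
\<close>

section \<open>The standard normal distribution function\<close>

definition Phi :: "real \<Rightarrow> real" where
  "Phi = cdf std_normal_distribution"

interpretation std_normal: real_distribution std_normal_distribution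
  by (rule real_dist_normal_dist)

lemma DERIV_std_normal_density [derivative_intros]:
  assumes "(g has_real_derivative D) (at x)"
  shows "((\<lambda>y. std_normal_density (g y)) has_real_derivative - g x * std_normal_density (g x) * D) (at x)"
proof -
  define c where "c = 1 / sqrt (2 * pi)"
  have "std_normal_density = (\<lambda>x. c * exp (- x\<^sup>2 / 2))"
    by (auto simp: std_normal_density_def c_def)
  then show ?thesis
    using assms by (auto intro!: derivative_eq_intros)
qed

lemma Phi_diff:
  assumes "a \<le> x"
  shows "Phi x - Phi a = integral {a..x} std_normal_density"
proof -
  have *: "emeasure std_normal_distribution {y} = 0" for y
    by (subst emeasure_density) (auto simp: nn_integral_indicator_singleton')
  have "Phi x - Phi a = measure std_normal_distribution {a<..x}"
    using assms by (cases "a = x") (auto simp: Phi_def std_normal.cdf_diff_eq)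
  \<comment> \<open>The law has no atoms, so adding the left endpoint changes nothing;
    \<open>cdf_diff_eq\<close> gives half-open intervals, the integral needs closed ones.\<close>
  also have "\<dots> = measure std_normal_distribution {a..x}"
  proof -
    have "{a..x} = insert a {a<..x}" using assms by auto
    moreover have "measure std_normal_distribution (insert a {a<..x}) =
        measure std_normal_distribution {a} + measure std_normal_distribution {a<..x}"
      by (subst std_normal.finite_measure_Union[symmetric]) auto
    ultimately show ?thesis using *[of a] by (simp add: measure_def)
  qed
  also have "\<dots> = (LINT y:{a..x}|lborel. std_normal_density y)"
  proof -
    have i: "set_integrable lborel {a..x} std_normal_density"
      by (intro borel_integrable_atLeastAtMost') (auto simp: std_normal_density_def intro!: continuous_intros)
    have "emeasure std_normal_distribution {a..x} = (\<integral>\<^sup>+y. ennreal (std_normal_density y * indicator {a..x} y) \<partial>lborel)"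
      by (subst emeasure_density) (auto intro!: nn_integral_cong simp: indicator_def)
    also have "\<dots> = ennreal (\<integral>y. std_normal_density y * indicator {a..x} y \<partial>lborel)"
      using i by (intro nn_integral_eq_integral) (auto simp: set_integrable_def mult.commute)
    finally show ?thesis
      by (simp add: measure_def set_lebesgue_integral_def mult.commute)
  qed
  also have "\<dots> = integral {a..x} std_normal_density"
    by (intro set_borel_integral_eq_integral(2) borel_integrable_atLeastAtMost')
       (auto simp: std_normal_density_def intro!: continuous_intros)
  finally show ?thesis .
qed

lemma DERIV_Phi: "(Phi has_real_derivative std_normal_density x) (at x)"
proof -
  have "((\<lambda>y. integral {x - 1..y} std_normal_density) has_real_derivative std_normal_density x) (at x within {x - 1..x + 1})"
    by (rule integral_has_real_derivative) (auto simp: std_normal_density_def intro!: continuous_intros)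
  then have "((\<lambda>y. integral {x - 1..y} std_normal_density) has_real_derivative std_normal_density x) (at x)"
    by (subst (asm) at_within_interior) auto
  then have "((\<lambda>y. Phi (x - 1) + integral {x - 1..y} std_normal_density) has_real_derivative std_normal_density x) (at x)"
    by (auto intro!: derivative_eq_intros)
  then show ?thesis
    by (rule has_field_derivative_transform_within_open[where S="{x - 1<..}"])
       (auto simp: Phi_diff[symmetric])
qed

lemma DERIV_Phi_compose [derivative_intros]:
  assumes "(g has_real_derivative D) (at x)"
  shows "((\<lambda>y. Phi (g y)) has_real_derivative std_normal_density (g x) * D) (at x)"
  using DERIV_chain2[OF DERIV_Phi assms] .

lemma Phi_strict_mono: "x < y \<Longrightarrow> Phi x < Phi y"
  by (rule DERIV_pos_imp_increasing) (auto intro!: exI DERIV_Phi simp: normal_density_pos)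

lemma Phi_le_iff: "Phi x \<le> Phi y \<longleftrightarrow> x \<le> y"
  using Phi_strict_mono by (metis linorder_not_less order.order_iff_strict)

lemma Phi_less_1: "Phi x < 1"
  using Phi_strict_mono[of x "x + 1"] std_normal.cdf_bounded_prob[of "x + 1"] by (simp add: Phi_def)

lemma Phi_at_top: "(Phi \<longlongrightarrow> 1) at_top" and Phi_at_bot: "(Phi \<longlongrightarrow> 0) at_bot"
  unfolding Phi_def by (rule std_normal.cdf_lim_at_top_prob std_normal.cdf_lim_at_bot)+

text \<open>The density is even, so \<open>Phi x + Phi (- x)\<close> has derivative 0; its constant
  value is the limit 1 at infinity.\<close>

lemma Phi_0: "Phi 0 = 1 / 2"
proof -
  have "((\<lambda>x. Phi x + Phi (- x)) has_real_derivative 0) (at x)" for x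
    by (auto intro!: derivative_eq_intros simp: std_normal_density_def)
  then have eq: "Phi x + Phi (- x) = Phi 0 + Phi (- 0)" for x
    by (rule DERIV_isconst_all[rule_format])
  have "((\<lambda>x. Phi x + Phi (- x)) \<longlongrightarrow> 1 + 0) at_top"
    by (intro tendsto_add Phi_at_top
        filterlim_compose[OF Phi_at_bot filterlim_uminus_at_bot_at_top])
  then have "((\<lambda>x::real. Phi 0 + Phi (- 0)) \<longlongrightarrow> 1 + 0) at_top"
    by (simp add: eq)
  then show ?thesis by (simp add: tendsto_const_iff)
qed

text \<open>\<open>Phi\<close> is continuous and strictly increasing, so the set under the
  \<open>Inf\<close> in \<open>quantile\<close> is a closed half-line starting at the unique
  preimage.\<close>

lemma Phi_z_upper:
  assumes "0 < \<beta>" "\<beta> < 1"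
  shows "Phi (z_upper \<beta>) = 1 - \<beta>"
proof -
  have "\<exists>a. Phi a < 1 - \<beta>"
    using order_tendstoD(2)[OF Phi_at_bot, of "1 - \<beta>"] assms
    by (auto simp: eventually_at_bot_linorder)
  then obtain a where a: "Phi a < 1 - \<beta>" ..
  have "\<exists>b. Phi b > 1 - \<beta>"
    using order_tendstoD(1)[OF Phi_at_top, of "1 - \<beta>"] assms
    by (auto simp: eventually_at_top_linorder)
  then obtain b where b: "Phi b > 1 - \<beta>" ..
  have "a \<le> b" using a b Phi_le_iff[of a b] by simp
  then obtain z where z: "Phi z = 1 - \<beta>"
    using IVT[of Phi a "1 - \<beta>" b] a b DERIV_isCont[OF DERIV_Phi] by force
  have "{x. Phi x \<ge> 1 - \<beta>} = {z..}"
    using Phi_le_iff[of z] z by auto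
  then show ?thesis by (simp add: z_upper_def quantile_def z flip: Phi_def)
qed

text \<open>The function \<open>?f\<close> tends to 1 and has derivative
  \<open>- std_normal_density y / y\<^sup>2\<close>, so it decreases to 1 from above.\<close>

lemma Mills_ratio_upper:
  assumes "v > 0"
  shows "1 - Phi v \<le> std_normal_density v / v"
proof -
  let ?f = "\<lambda>x. std_normal_density x / x + Phi x"
  have "(?f \<longlongrightarrow> 0 + 1) at_top"
  proof (intro tendsto_add Phi_at_top)
    have "((\<lambda>x. 1 / sqrt (2 * pi) * exp (- x\<^sup>2 / 2) / x) \<longlongrightarrow> 0) at_top"
    proof (rule tendsto_sandwich[where f="\<lambda>_. 0" and h="\<lambda>x. 1 / sqrt (2 * pi) * inverse x"])
      show "\<forall>\<^sub>F x in at_top. 1 / sqrt (2 * pi) * exp (- x\<^sup>2 / 2) / x \<le> 1 / sqrt (2 * pi) * inverse x"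
        using eventually_gt_at_top[of 0] by eventually_elim (auto simp: field_simps)
      show "((\<lambda>x. 1 / sqrt (2 * pi) * inverse x) \<longlongrightarrow> 0) at_top"
        by (intro tendsto_mult_right_zero tendsto_inverse_0_at_top filterlim_ident)
      show "\<forall>\<^sub>F x in at_top. 0 \<le> 1 / sqrt (2 * pi) * exp (- x\<^sup>2 / 2) / x"
        using eventually_gt_at_top[of 0] by eventually_elim simp
    qed simp
    then show "((\<lambda>x. std_normal_density x / x) \<longlongrightarrow> 0) at_top"
      by (simp add: std_normal_density_def)
  qed
  moreover have "?f x \<le> ?f v" if "v \<le> x" for x
  proof (rule DERIV_nonpos_imp_nonincreasing[OF that])
    fix y assume y: "v \<le> y" "y \<le> x"
    have "(?f has_real_derivative - (std_normal_density y / y\<^sup>2)) (at y)"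
      using y assms by (auto intro!: derivative_eq_intros simp: field_simps power2_eq_square)
    then show "\<exists>D. (?f has_real_derivative D) (at y) \<and> D \<le> 0"
      by force
  qed
  ultimately have "0 + 1 \<le> ?f v"
    by (intro tendsto_upperbound[where F=at_top]) (auto intro!: eventually_at_top_linorderI[of v])
  then show ?thesis by simp
qed

section \<open>Binomial tails\<close>

definition bprob :: "nat \<Rightarrow> nat \<Rightarrow> real" where
  "bprob n j = real (n choose j) / 2 ^ n"

definition btail :: "nat \<Rightarrow> nat \<Rightarrow> real" where
  "btail n j = (\<Sum>i=j..n. bprob n i)"

lemma bprob_nonneg [simp]: "0 \<le> bprob n j"
  by (simp add: bprob_def)

lemma bprob_eq_0: "n < j \<Longrightarrow> bprob n j = 0"
  by (simp add: bprob_def)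

lemma bprob_symmetric: "j \<le> n \<Longrightarrow> bprob n (n - j) = bprob n j"
  using binomial_symmetric[of j n] by (simp add: bprob_def)

lemma bprob_Suc_Suc: "bprob (Suc n) (Suc j) = (bprob n j + bprob n (Suc j)) / 2"
  by (simp add: bprob_def field_simps)

lemma bprob_Suc: "real (j + 1) * bprob n (Suc j) = (real n - real j) * bprob n j"
proof (cases "j \<le> n")
  case True
  have "Suc j * (n choose Suc j) = (n - j) * (n choose j)"
    using binomial_absorption[of j n] binomial_absorb_comp[of n j] by (rule trans[OF _ sym])
  then have "real (Suc j) * real (n choose Suc j) = real (n - j) * real (n choose j)"
    by (metis of_nat_mult)
  then show ?thesis
    using True by (simp add: bprob_def of_nat_diff)
qed (simp add: bprob_eq_0)

lemma btail_eq_0: "n < j \<Longrightarrow> btail n j = 0"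
  by (simp add: btail_def)

lemma btail_Suc: "btail n j = bprob n j + btail n (Suc j)"
proof (cases "j \<le> n")
  case True
  then show ?thesis by (simp add: btail_def sum.atLeast_Suc_atMost)
qed (simp add: btail_eq_0 bprob_eq_0)

lemma btail_antimono: "i \<le> j \<Longrightarrow> btail n j \<le> btail n i"
  unfolding btail_def by (intro sum_mono2) auto

lemma btail_0: "btail n 0 = 1"
proof -
  have "(\<Sum>i\<le>n. real (n choose i)) = 2 ^ n"
    using choose_row_sum[of n] by (metis of_nat_numeral of_nat_power of_nat_sum)
  then show ?thesis
    by (simp add: btail_def bprob_def atLeast0AtMost flip: sum_divide_distrib)
qed

text \<open>Pascal's rule, i.e. conditioning on one fair coin. It drives the reduction of odd
  \<open>n\<close> to even \<open>n\<close> and the stochastic domination behind the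
  coverage.\<close>

lemma btail_Suc_Suc: "btail (Suc n) (Suc j) = (btail n j + btail n (Suc j)) / 2"
proof -
  have "btail (Suc n) (Suc j) = (\<Sum>i=j..n. bprob (Suc n) (Suc i))"
    unfolding btail_def by (simp only: sum.atLeast_Suc_atMost_Suc_shift o_def)
  also have "\<dots> = (btail n j + (\<Sum>i=j..n. bprob n (Suc i))) / 2"
    by (simp add: bprob_Suc_Suc btail_def sum_divide_distrib add_divide_distrib sum.distrib)
  also have "(\<Sum>i=j..n. bprob n (Suc i)) = (\<Sum>i=Suc j..Suc n. bprob n i)"
    by (simp only: sum.atLeast_Suc_atMost_Suc_shift o_def)
  also have "\<dots> = btail n (Suc j)"
    unfolding btail_def by (intro sum.mono_neutral_right) (auto simp: bprob_eq_0)
  finally show ?thesis .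
qed

lemma sum_bprob_lessThan:
  assumes "k \<le> Suc n"
  shows "(\<Sum>i<k. bprob n i) = btail n (Suc n - k)"
  unfolding btail_def
  by (rule sum.reindex_bij_witness[of _ "\<lambda>i. n - i" "\<lambda>i. n - i"])
     (use assms in \<open>auto simp: bprob_symmetric\<close>)

lemma btail_reflect:
  assumes "k \<le> Suc n"
  shows "btail n k = 1 - btail n (Suc n - k)"
proof -
  have "(\<Sum>i<k. bprob n i) + btail n k = btail n 0"
  proof -
    have "{0..n} = {..<k} \<union> {k..n}" using assms by auto
    moreover have "{..<k} \<inter> {k..n} = {}" by auto
    ultimately show ?thesis
      unfolding btail_def by (simp add: sum.union_disjoint)
  qed
  then show ?thesis
    using sum_bprob_lessThan[OF assms] by (simp add: btail_0)
qed

text \<open>Beyond the centre the tail is no larger than its mirror image's complement, and the two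
  add up to 1.\<close>

lemma btail_le_half:
  assumes "n < 2 * k"
  shows "btail n k \<le> 1 / 2"
proof (cases "k \<le> n")
  case True
  then have "btail n k \<le> btail n (Suc n - k)"
    using assms by (intro btail_antimono) linarith
  then show ?thesis
    using btail_reflect[of k n] True by linarith
qed (simp add: btail_eq_0)

lemma btail_top: "btail n n = 1 / 2 ^ n"
  by (simp add: btail_def bprob_def)

section \<open>From the binomial law to the critical value\<close>

lemma prob_binomial_ge:
  "measure_pmf.prob (binomial_pmf n (1/2)) {k..} = btail n k"
proof -
  have "measure_pmf.prob (binomial_pmf n (1/2)) {k..} = measure_pmf.prob (binomial_pmf n (1/2)) {k..n}"
    by (rule measure_prob_cong_0) (auto simp: pmf_eq_0_set_pmf)
  also have "\<dots> = btail n k"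
  proof -
    have "pmf (binomial_pmf n (1/2)) i = bprob n i" if "i \<le> n" for i
    proof -
      have "(1/2::real) ^ i * (1/2) ^ (n - i) = (1/2) ^ n"
        using that by (simp flip: power_add)
      then show ?thesis by (simp add: bprob_def power_divide)
    qed
    then show ?thesis
      by (simp add: measure_measure_pmf_finite btail_def)
  qed
  finally show ?thesis .
qed

text \<open>By symmetry of the binomial law, the event defining \<^const>\<open>c_crit\<close> is the complement of an upper
  tail, which starts at \<open>\<lceil>n / 2\<rceil> + 1 + x\<close>.\<close>

definition upper_rank :: "nat \<Rightarrow> nat" where
  "upper_rank n = Suc n - n div 2"

lemma prob_crit:
  "measure_pmf.prob (binomial_pmf n (1/2)) {y. int y \<ge> \<lfloor>real n / 2\<rfloor> - int x} = 1 - btail n (upper_rank n + x)"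
proof -
  have fl: "\<lfloor>real n / 2\<rfloor> = int (n div 2)"
    using floor_divide_of_nat_eq[of n 2] by simp
  have "{y. int y \<ge> \<lfloor>real n / 2\<rfloor> - int x} = {n div 2 - x..}"
    unfolding fl by auto
  moreover have "btail n (n div 2 - x) = 1 - btail n (upper_rank n + x)"
  proof (cases "x \<le> n div 2")
    case True
    then have "Suc n - (n div 2 - x) = upper_rank n + x"
      by (auto simp: upper_rank_def)
    then show ?thesis
      using btail_reflect[of "n div 2 - x" n] by simp
  next
    case False
    then have "btail n (upper_rank n + x) = 0"
      by (intro btail_eq_0) (auto simp: upper_rank_def)
    then show ?thesis using False by (simp add: btail_0)
  qed
  ultimately show ?thesis by (simp only: prob_binomial_ge)
qed

text \<open>The least integer is in fact a least natural number: for negative \<open>x\<close> the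
  event lies in \<open>Y > n div 2\<close>, whose probability is at most 1/2 and hence below 1 -
  \<alpha>/2.\<close>

lemma c_crit:
  assumes "0 < \<alpha>" "\<alpha> < 1"
  shows "\<exists>c. c_crit n \<alpha> = int c \<and> c \<le> n div 2 \<and>
    (\<forall>x. btail n (upper_rank n + x) \<le> \<alpha> / 2 \<longleftrightarrow> c \<le> x)"
proof -
  define P where "P x \<longleftrightarrow> measure_pmf.prob (binomial_pmf n (1/2)) {y. int y \<ge> \<lfloor>real n / 2\<rfloor> - x} \<ge> 1 - \<alpha> / 2" for x :: int
  define Q where "Q x \<longleftrightarrow> btail n (upper_rank n + x) \<le> \<alpha> / 2" for x :: nat
  have PQ: "P (int x) = Q x" for x
    unfolding P_def Q_def prob_crit by simp
  have Q_mono: "Q y" if "Q x" "x \<le> y" for x y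
    using that btail_antimono[of "upper_rank n + x" "upper_rank n + y" n] by (auto simp: Q_def)
  have Q_half: "Q (n div 2)"
    using assms by (simp add: Q_def upper_rank_def btail_eq_0)
  define c where "c = (LEAST x. Q x)"
  have c: "Q x \<longleftrightarrow> c \<le> x" for x
    using LeastI[of Q, OF Q_half] Least_le[of Q x] Q_mono[of c x] unfolding c_def by blast
  have P_nonneg: "0 \<le> x" if "P x" for x
  proof (rule ccontr)
    assume "\<not> 0 \<le> x"
    then have "{y. int y \<ge> \<lfloor>real n / 2\<rfloor> - x} \<subseteq> {Suc (n div 2)..}"
      using floor_divide_of_nat_eq[of n 2, where ?'a = real] by (auto simp: Suc_le_eq)
    then have "measure_pmf.prob (binomial_pmf n (1/2)) {y. int y \<ge> \<lfloor>real n / 2\<rfloor> - x} \<le> btail n (Suc (n div 2))"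
      unfolding prob_binomial_ge[symmetric] by (intro measure_pmf.finite_measure_mono) auto
    also have "\<dots> \<le> 1 / 2"
      by (intro btail_le_half) presburger
    finally show False using that assms by (simp add: P_def)
  qed
  have "c_crit n \<alpha> = int c"
    unfolding c_crit_def P_def[symmetric]
  proof (rule Least_equality)
    show "P (int c)" using PQ c by blast
    show "int c \<le> y" if "P y" for y
      using P_nonneg[OF that] that PQ[of "nat y"] c[of "nat y"] by simp
  qed
  then show ?thesis using c Q_half unfolding Q_def by blast
qed

section \<open>Central binomial weights\<close>

lemma bprob_odd_central: "bprob (Suc (2 * m)) (Suc m) = bprob (2 * Suc m) (Suc m)"
proof -
  have "bprob (2 * Suc m) (Suc m) = (bprob (Suc (2 * m)) m + bprob (Suc (2 * m)) (Suc m)) / 2"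
    by (simp add: bprob_Suc_Suc)
  then show ?thesis
    using bprob_symmetric[of m "Suc (2 * m)"] by (simp add: Suc_diff_le)
qed

text \<open>Wallis' product is increasing, and its partial products are \<open>1 / (b\<^sup>2 (2 m + 1))\<close> with \<open>b\<close>
  the central binomial probability.\<close>

lemma bprob_central_ge: "bprob (2 * m) m \<ge> sqrt (2 / (pi * (2 * m + 1)))"
proof -
  define u where "u m = (\<Prod>k=1..m. (4 * real k ^ 2) / (4 * real k ^ 2 - 1))" for m :: nat
  have u: "u m = 1 / ((bprob (2 * m) m)\<^sup>2 * (2 * real m + 1))" for m
  proof (induction m)
    case 0
    then show ?case by (simp add: u_def bprob_def)
  next
    case (Suc m)
    define b where "b = bprob (2 * m) m"
    have b: "b > 0" by (simp add: b_def bprob_def)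
    have A: "2 * bprob (Suc (2 * m)) (Suc m) = bprob (2 * m) m + bprob (2 * m) (Suc m)"
      by (simp add: bprob_Suc_Suc)
    have "2 * bprob (2 * Suc m) (Suc m) = b + bprob (2 * m) (Suc m)"
      using A by (simp only: b_def bprob_odd_central)
    moreover have "(real m + 1) * bprob (2 * m) (Suc m) = real m * b"
      using bprob_Suc[of m "2 * m"] by (simp add: b_def add.commute)
    ultimately have step: "bprob (2 * Suc m) (Suc m) = b * (2 * real m + 1) / (2 * real m + 2)"
      by (simp add: field_simps)
    define p q r where "p = 2 * real m + 1" and "q = 2 * real m + 2" and "r = 2 * real m + 3"
    have pos: "p > 0" "q > 0" "r > 0" by (simp_all add: p_def q_def r_def)
    have *: "4 * (real (Suc m))\<^sup>2 = q\<^sup>2" "4 * (real (Suc m))\<^sup>2 - 1 = p * r"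
      by (simp_all add: power2_eq_square algebra_simps p_def q_def r_def)
    have "u (Suc m) = u m * (4 * (real (Suc m))\<^sup>2 / (4 * (real (Suc m))\<^sup>2 - 1))"
      by (simp add: u_def)
    also have "\<dots> = 1 / (b\<^sup>2 * p) * (q\<^sup>2 / (p * r))"
      unfolding *(2) unfolding *(1) Suc by (simp add: b_def p_def)
    also have "\<dots> = 1 / ((b * p / q)\<^sup>2 * r)"
      using b pos by (simp add: divide_simps power2_eq_square)
    also have "b * p / q = bprob (2 * Suc m) (Suc m)"
      unfolding step p_def q_def ..
    also have "r = 2 * real (Suc m) + 1" by (simp add: r_def)
    finally show ?case .
  qed
  have "incseq u"
  proof (rule incseq_SucI)
    fix m
    have "u m * 1 \<le> u m * (4 * real (Suc m) ^ 2 / (4 * real (Suc m) ^ 2 - 1))"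
    proof (rule mult_left_mono)
      have "4 * real (Suc m) ^ 2 - 1 > 0"
        by (simp add: power2_eq_square algebra_simps add_pos_nonneg)
      then show "1 \<le> 4 * real (Suc m) ^ 2 / (4 * real (Suc m) ^ 2 - 1)"
        by simp
      show "0 \<le> u m" by (simp add: u)
    qed
    then show "u m \<le> u (Suc m)" by (simp add: u_def)
  qed
  moreover have "u \<longlonglongrightarrow> pi / 2"
    using wallis unfolding u_def[abs_def] .
  ultimately have "u m \<le> pi / 2"
    by (rule incseq_le)
  moreover have "bprob (2 * m) m > 0" by (simp add: bprob_def)
  ultimately have "2 / (pi * (2 * real m + 1)) \<le> (bprob (2 * m) m)\<^sup>2"
    unfolding u using pi_gt_zero by (simp add: divide_simps mult.commute mult.left_commute)
  then show ?thesis
    by (intro real_le_lsqrt) (simp_all add: add.commute)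
qed

section \<open>Upper bound on binomial tails\<close>

lemma std_normal_density_cosh:
  "std_normal_density (c + t) + std_normal_density (c - t)
     = 2 * std_normal_density c * exp (- t\<^sup>2 / 2) * cosh (c * t)"
proof -
  have *: "- (c + t)\<^sup>2 / 2 = - c\<^sup>2 / 2 + - t\<^sup>2 / 2 + - (c * t)"
          "- (c - t)\<^sup>2 / 2 = - c\<^sup>2 / 2 + - t\<^sup>2 / 2 + c * t"
    by (simp_all add: power2_eq_square field_simps)
  show ?thesis
    unfolding std_normal_density_def * exp_add cosh_def by (simp add: algebra_simps add_divide_distrib)
qed

text \<open>Differentiate in the half-width: the pair of boundary densities is a density at the
  centre times a cosh factor. The exponential is exactly the ratio of the central densities, and the
  cosh factor grows with the centre.\<close>

lemma Phi_window_ratio: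
  assumes "0 \<le> c" "c \<le> d" "0 \<le> \<delta>"
  shows "exp ((c\<^sup>2 - d\<^sup>2) / 2) * (Phi (c + \<delta>) - Phi (c - \<delta>)) \<le> Phi (d + \<delta>) - Phi (d - \<delta>)"
proof -
  define E where "E = exp ((c\<^sup>2 - d\<^sup>2) / 2)"
  define f where "f t = Phi (d + t) - Phi (d - t) - E * (Phi (c + t) - Phi (c - t))" for t
  have E: "std_normal_density d = E * std_normal_density c"
    by (simp add: std_normal_density_def E_def diff_divide_distrib flip: exp_add)
  have "f 0 \<le> f \<delta>"
  proof (rule DERIV_nonneg_imp_nondecreasing[OF assms(3)])
    fix t assume t: "0 \<le> t" "t \<le> \<delta>"
    have "(f has_real_derivative (std_normal_density (d + t) + std_normal_density (d - t))
        - E * (std_normal_density (c + t) + std_normal_density (c - t))) (at t)"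
      unfolding f_def by (auto intro!: derivative_eq_intros)
    moreover have "cosh (c * t) \<le> cosh (d * t)"
      using assms t by (subst cosh_real_nonneg_le_iff) (auto intro: mult_right_mono)
    then have "E * (std_normal_density (c + t) + std_normal_density (c - t))
        \<le> std_normal_density (d + t) + std_normal_density (d - t)"
      using mult_left_mono[of "cosh (c * t)" "cosh (d * t)" "2 * E * std_normal_density c * exp (- t\<^sup>2 / 2)"]
      unfolding std_normal_density_cosh E by (simp add: E_def algebra_simps)
    ultimately show "\<exists>D. (f has_real_derivative D) (at t) \<and> 0 \<le> D"
      by (metis diff_ge_0_iff_ge)
  qed
  then show ?thesis by (simp add: f_def E_def)
qed

text \<open>Read as \<open>(1 - a) / (1 + a) \<le> exp (- 2 * a)\<close>, this bounds the ratio of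
  consecutive binomial weights by the ratio that the normal cells satisfy.\<close>

lemma one_minus_le_exp:
  fixes a :: real
  assumes "0 \<le> a"
  shows "1 - a \<le> (1 + a) * exp (- 2 * a)"
proof -
  define f where "f a = (1 + a) * exp (- a) - (1 - a) * exp a" for a :: real
  have "f 0 \<le> f a"
  proof (rule DERIV_nonneg_imp_nondecreasing[OF assms])
    fix t :: real assume t: "0 \<le> t"
    have "(f has_real_derivative t * (exp t - exp (- t))) (at t)"
      unfolding f_def by (auto intro!: derivative_eq_intros simp: algebra_simps)
    then show "\<exists>D. (f has_real_derivative D) (at t) \<and> 0 \<le> D"
      using t by (intro exI[of _ "t * (exp t - exp (- t))"]) auto
  qed
  then have "(1 - a) * exp a \<le> (1 + a) * exp (- a)" by (simp add: f_def)
  then have "(1 - a) * exp a * exp (- a) \<le> (1 + a) * exp (- a) * exp (- a)"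
    by (rule mult_right_mono) simp
  then show ?thesis by (simp add: mult.assoc flip: exp_add)
qed

text \<open>With \<open>h = sqrt (2 / m)\<close>, the ratio of the binomial weight at \<open>m + i\<close> to the normal mass of
  \<open>[(i - 1) h, i h]\<close> decreases in \<open>i\<close>, so the difference of the weights changes sign at most once.
  Beyond the sign change the tails compare termwise; before it, the complements do, as both tails
  are at most \<open>1/2\<close> at \<open>0\<close>.\<close>

lemma btail_even_le:
  assumes m: "m \<ge> 1"
  shows "btail (2 * m) (m + k + 1) \<le> 1 - Phi (real k * sqrt (2 / real m))"
proof -
  define h where "h = sqrt (2 / real m)"
  have h: "h > 0" "h\<^sup>2 = 2 / real m" using m by (auto simp: h_def)
  define b where "b i = bprob (2 * m) (m + i)" for i
  define g where "g i = Phi (real i * h) - Phi ((real i - 1) * h)" for i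
  have g_pos: "g i > 0" for i
    using Phi_strict_mono[of "(real i - 1) * h" "real i * h"] h by (simp add: g_def algebra_simps)
  have g_Suc: "exp (- (2 * real i / real m)) * g i \<le> g (Suc i)" if "i \<ge> 1" for i
  proof -
    \<comment> \<open>The midpoints of two consecutive cells. Their squares differ by
      \<open>2 * real i * h\<^sup>2\<close>, so this choice of \<open>h\<close> makes the exponent
      the one of the binomial ratio bound.\<close>
    define c d where "c = (real i - 1/2) * h" and "d = (real i + 1/2) * h"
    have "(c\<^sup>2 - d\<^sup>2) / 2 = - real i * h\<^sup>2"
      by (simp add: c_def d_def power2_eq_square algebra_simps)
    then have "(c\<^sup>2 - d\<^sup>2) / 2 = - (2 * real i / real m)" by (simp add: h)
    moreover have "0 \<le> c" "c \<le> d" using that h by (auto simp: c_def d_def)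
    moreover have "c + h / 2 = real i * h" "c - h / 2 = (real i - 1) * h"
       "d + h / 2 = (real i + 1) * h" "d - h / 2 = real i * h"
      by (simp_all add: c_def d_def algebra_simps)
    ultimately show ?thesis
      using Phi_window_ratio[of c d "h / 2"] h by (simp add: g_def add.commute)
  qed
  have b_Suc: "b (Suc i) \<le> exp (- (2 * real i / real m)) * b i" for i
  proof -
    have "real (m + i + 1) * b (Suc i) = (real m - real i) * b i"
      using bprob_Suc[of "m + i" "2 * m"] by (simp add: b_def)
    moreover have "real (m + i) * b (Suc i) \<le> real (m + i + 1) * b (Suc i)"
      by (intro mult_right_mono) (auto simp: b_def)
    moreover have "(real m - real i) * b i \<le> real (m + i) * exp (- (2 * real i / real m)) * b i"
    proof (rule mult_right_mono)
      have "real m * (1 - real i / real m) \<le> real m * ((1 + real i / real m) * exp (- 2 * (real i / real m)))"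
        by (intro mult_left_mono one_minus_le_exp) auto
      then show "real m - real i \<le> real (m + i) * exp (- (2 * real i / real m))"
        using m by (simp add: algebra_simps)
    qed (simp add: b_def)
    ultimately have "real (m + i) * b (Suc i) \<le> real (m + i) * (exp (- (2 * real i / real m)) * b i)"
      by (simp add: mult.assoc)
    then show ?thesis using m by (subst (asm) mult_le_cancel_left_pos) auto
  qed
  have step: "b (Suc i) \<le> g (Suc i)" if "b i \<le> g i" "i \<ge> 1" for i
  proof -
    have "b (Suc i) \<le> exp (- (2 * real i / real m)) * g i"
      by (rule order_trans[OF b_Suc mult_left_mono[OF that(1)]]) simp
    then show ?thesis using g_Suc[OF that(2)] by simp
  qed
  show ?thesis
  proof (cases "\<exists>i\<in>{1..Suc k}. b i \<le> g i")
    case True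
    then obtain i where i: "1 \<le> i" "i \<le> Suc k" "b i \<le> g i" by auto
    have dom: "b l \<le> g l" if "i \<le> l" for l
      using that by (induction rule: dec_induct) (use i step in auto)
    \<comment> \<open>Downward induction from \<open>l = m\<close>, where the binomial tail is
      empty.\<close>
    have "btail (2 * m) (m + l + 1) \<le> 1 - Phi (real l * h)" if "k \<le> l" "l \<le> m" for l
      using that(2,1)
    proof (induction rule: inc_induct)
      case base
      show ?case using Phi_less_1[of "real m * h"] by (simp add: btail_eq_0)
    next
      case (step l)
      have "btail (2 * m) (m + l + 1) = b (Suc l) + btail (2 * m) (m + Suc l + 1)"
        using btail_Suc[of "2 * m" "m + l + 1"] by (simp add: b_def)
      also have "\<dots> \<le> g (Suc l) + (1 - Phi (real (Suc l) * h))"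
        using step i by (intro add_mono dom) auto
      finally show ?case by (simp add: g_def)
    qed
    then have *: "k \<le> m \<Longrightarrow> ?thesis" by (simp add: h_def)
    show ?thesis
    proof (cases "k \<le> m")
      case False
      then show ?thesis using Phi_less_1[of "real k * h"] by (simp add: btail_eq_0 h_def)
    qed (rule *)
  next
    case False
    have "btail (2 * m) (m + l + 1) \<le> 1 - Phi (real l * h)" if "l \<le> k" for l
      using that
    proof (induction l)
      case 0
      show ?case using btail_le_half[of "2 * m" "m + 1"] by (simp add: Phi_0)
    next
      case (Suc l)
      have "btail (2 * m) (m + Suc l + 1) = btail (2 * m) (m + l + 1) - b (Suc l)"
        using btail_Suc[of "2 * m" "m + l + 1"] by (simp add: b_def)
      also have "\<dots> \<le> 1 - Phi (real l * h) - g (Suc l)"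
      proof (rule diff_mono)
        have "\<not> b (Suc l) \<le> g (Suc l)" using Suc.prems False by auto
        then show "g (Suc l) \<le> b (Suc l)" by simp
      qed (use Suc in simp)
      finally show ?case by (simp add: g_def)
    qed
    then show ?thesis by (simp add: h_def)
  qed
qed

text \<open>For odd \<open>n\<close> Pascal's rule bounds the tail by one of the even row
  \<open>n - 1\<close>, and the larger spacing \<open>sqrt (2 / m)\<close> only helps. The case
  \<open>n = 1\<close>, where \<open>m\<close> would be 0, has an empty tail.\<close>

lemma btail_le_Phi:
  assumes n: "n \<ge> 1" and c: "c \<ge> 1"
  shows "btail n (upper_rank n + c) \<le> 1 - Phi (2 * real c / sqrt (real n))"
proof (cases "n = 1")
  case True
  then show ?thesis
    using Phi_less_1[of "2 * real c"] c by (simp add: upper_rank_def btail_eq_0)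
next
  case False
  define m where "m = n div 2"
  have m: "m \<ge> 1" using n False by (simp add: m_def)
  have nm: "n = 2 * m \<or> n = Suc (2 * m)" by (auto simp: m_def)
  have "btail n (upper_rank n + c) \<le> btail (2 * m) (m + c + 1)"
    using nm
  proof
    assume "n = Suc (2 * m)"
    then show ?thesis
      using btail_Suc_Suc[of "2 * m" "m + c + 1"] btail_antimono[of "m + c + 1" "Suc (m + c + 1)" "2 * m"]
      by (simp add: upper_rank_def)
  qed (simp add: upper_rank_def)
  also have "\<dots> \<le> 1 - Phi (real c * sqrt (2 / real m))"
    by (rule btail_even_le[OF m])
  also have "\<dots> \<le> 1 - Phi (2 * real c / sqrt (real n))"
  proof -
    have "2 / sqrt (real n) = sqrt (4 / real n)" by (simp add: real_sqrt_divide)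
    also have "\<dots> \<le> sqrt (2 / real m)"
      using nm m by (intro real_sqrt_le_mono) (auto simp: divide_simps)
    finally have "real c * (2 / sqrt (real n)) \<le> real c * sqrt (2 / real m)"
      by (intro mult_left_mono) auto
    then show ?thesis by (simp add: Phi_le_iff mult.commute)
  qed
  finally show ?thesis .
qed

section \<open>Lower bound on binomial tails\<close>

text \<open>The Legendre transform of \<open>ln \<circ> cosh\<close>, i.e. the large deviation rate of the fair coin.\<close>

definition dev :: "real \<Rightarrow> real" where
  "dev s = ((1 + s) * ln (1 + s) + (1 - s) * ln (1 - s)) / 2"

lemma dev_0 [simp]: "dev 0 = 0"
  by (simp add: dev_def)

lemma DERIV_dev [derivative_intros]:
  assumes "(g has_real_derivative D) (at x)" "\<bar>g x\<bar> < 1"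
  shows "((\<lambda>x. dev (g x)) has_real_derivative artanh (g x) * D) (at x)"
proof -
  have "(dev has_real_derivative (ln (1 + y) - ln (1 - y)) / 2) (at y)" if "\<bar>y\<bar> < 1" for y
  proof -
    have "1 + y > 0" "1 - y > 0" using that by auto
    then show ?thesis
      unfolding dev_def by (auto intro!: derivative_eq_intros)
  qed
  moreover have "(ln (1 + y) - ln (1 - y)) / 2 = artanh y" if "\<bar>y\<bar> < 1" for y :: real
    using that by (auto simp: artanh_def ln_div)
  ultimately show ?thesis
    using DERIV_chain2[OF _ assms(1), of dev] assms(2) by simp
qed

text \<open>The rational bounds on the logarithm come from truncating the series of \<^const>\<open>artanh\<close>; they are
  sharp enough to leave an \<open>s\<^sup>4\<close> coefficient of \<open>1/12\<close> in the bound on \<^const>\<open>dev\<close> at \<open>0\<close> and still give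
  less than \<open>1/2 + 1/5\<close> at \<open>1\<close>.\<close>

lemma ln_one_plus_le:
  fixes s :: real
  assumes "0 \<le> s"
  shows "ln (1 + s) \<le> 2 * s / (2 + s) + s ^ 3 / (6 * (2 + s) * (1 + s))"
proof -
  define f where "f s = 2 * s / (2 + s) + s ^ 3 / (6 * (2 + s) * (1 + s)) - ln (1 + s)" for s :: real
  have "f 0 \<le> f s"
  proof (rule DERIV_nonneg_imp_nondecreasing[OF assms])
    fix t :: real assume t: "0 \<le> t"
    define D where "D = 4 / (2 + t)\<^sup>2 + (3 * t\<^sup>2 * (6 * (2 + t) * (1 + t)) - t ^ 3 * (18 + 12 * t)) / (6 * (2 + t) * (1 + t))\<^sup>2 - 1 / (1 + t)"
    have "(f has_real_derivative D) (at t)"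
      unfolding f_def D_def using t
      by (auto intro!: derivative_eq_intros simp: power2_eq_square power3_eq_cube)
    moreover have "D = t ^ 4 / (6 * (1 + t)\<^sup>2 * (2 + t)\<^sup>2)"
    proof -
      have "2 + t \<noteq> 0" "1 + t \<noteq> 0" using t by auto
      then show ?thesis
        unfolding D_def by (simp add: divide_simps) algebra
    qed
    ultimately show "\<exists>D. (f has_real_derivative D) (at t) \<and> 0 \<le> D"
      by auto
  qed
  then show ?thesis by (simp add: f_def)
qed

lemma ln_one_minus_le:
  fixes s :: real
  assumes "0 \<le> s" "s < 1"
  shows "ln (1 - s) \<le> - (2 * s / (2 - s) + 2 * s ^ 3 / (3 * (2 - s) ^ 3))"
proof -
  define f where "f s = - ln (1 - s) - (2 * s / (2 - s) + 2 * s ^ 3 / (3 * (2 - s) ^ 3))" for s :: real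
  have "f 0 \<le> f s"
  proof (rule DERIV_nonneg_imp_nondecreasing[OF assms(1)])
    fix t :: real assume t: "0 \<le> t" "t \<le> s"
    define D where "D = 1 / (1 - t) - (4 / (2 - t)\<^sup>2 + 4 * t\<^sup>2 / (2 - t) ^ 4)"
    have nz: "2 - t \<noteq> 0" "1 - t > 0" using t assms by auto
    have "(f has_real_derivative D) (at t)"
      unfolding f_def D_def using nz
      by (auto intro!: derivative_eq_intros simp: power2_eq_square power3_eq_cube power4_eq_xxxx)
         (simp add: divide_simps, algebra)
    moreover have "D = t ^ 4 / ((1 - t) * (2 - t) ^ 4)"
      unfolding D_def using nz by (simp add: divide_simps, algebra)
    ultimately show "\<exists>D. (f has_real_derivative D) (at t) \<and> 0 \<le> D"
      using nz by (intro exI[of _ D]) auto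
  qed
  then show ?thesis by (simp add: f_def)
qed

section \<open>Inequalities for artanh and the rate function\<close>

lemma artanh_ge:
  fixes s :: real
  assumes "0 \<le> s" "s < 1"
  shows "s + s ^ 3 / 3 \<le> artanh s"
proof -
  define f where "f s = artanh s - (s + s ^ 3 / 3)" for s :: real
  have "f 0 \<le> f s"
  proof (rule DERIV_nonneg_imp_nondecreasing[OF assms(1)])
    fix t :: real assume t: "0 \<le> t" "t \<le> s"
    have "(f has_real_derivative 1 / (1 - t\<^sup>2) - (1 + t\<^sup>2)) (at t)"
      unfolding f_def using t assms by (auto intro!: derivative_eq_intros)
    moreover have "1 - t\<^sup>2 > 0" using t assms by (simp add: abs_square_less_1)
    then have "1 / (1 - t\<^sup>2) - (1 + t\<^sup>2) = t ^ 4 / (1 - t\<^sup>2)"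
      by (simp add: field_simps)
    ultimately show "\<exists>D. (f has_real_derivative D) (at t) \<and> 0 \<le> D"
      using \<open>1 - t\<^sup>2 > 0\<close> by (intro exI[of _ "t ^ 4 / (1 - t\<^sup>2)"]) auto
  qed
  then show ?thesis by (simp add: f_def)
qed

text \<open>The midpoint rule underestimates the integral of the convex function \<^const>\<open>artanh\<close>.\<close>

lemma dev_midpoint:
  fixes \<sigma> \<epsilon> :: real
  assumes "0 \<le> \<epsilon>" "\<epsilon> \<le> \<sigma>" "\<sigma> + \<epsilon> < 1"
  shows "2 * \<epsilon> * artanh \<sigma> \<le> dev (\<sigma> + \<epsilon>) - dev (\<sigma> - \<epsilon>)"
proof -
  define f where "f e = dev (\<sigma> + e) - dev (\<sigma> - e) - 2 * e * artanh \<sigma>" for e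
  have "f 0 \<le> f \<epsilon>"
  proof (rule DERIV_nonneg_imp_nondecreasing[OF assms(1)])
    fix e assume e: "0 \<le> e" "e \<le> \<epsilon>"
    have "(f has_real_derivative artanh (\<sigma> + e) + artanh (\<sigma> - e) - 2 * artanh \<sigma>) (at e)"
      unfolding f_def using e assms by (auto intro!: derivative_eq_intros)
    \<comment> \<open>Midpoint convexity, written as a comparison of the arguments of the
      logarithms; it comes down to
      \<open>(1 - \<sigma>)\<^sup>2 \<le> (1 + \<sigma>)\<^sup>2\<close>.\<close>
    moreover have "2 * artanh \<sigma> \<le> artanh (\<sigma> + e) + artanh (\<sigma> - e)"
    proof -
      have pos: "1 + (\<sigma> + e) > 0" "1 - (\<sigma> + e) > 0" "1 + (\<sigma> - e) > 0" "1 - (\<sigma> - e) > 0" "1 + \<sigma> > 0" "1 - \<sigma> > 0"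
        using e assms by auto
      have eq: "(1 + (\<sigma> + e)) * (1 + (\<sigma> - e)) = (1 + \<sigma>)\<^sup>2 - e\<^sup>2" "(1 - (\<sigma> + e)) * (1 - (\<sigma> - e)) = (1 - \<sigma>)\<^sup>2 - e\<^sup>2"
        by (simp_all add: power2_eq_square algebra_simps)
      have pos2: "(1 + \<sigma>)\<^sup>2 - e\<^sup>2 > 0" "(1 - \<sigma>)\<^sup>2 - e\<^sup>2 > 0"
        using pos by (simp_all flip: eq)
      have "2 * artanh \<sigma> = artanh \<sigma> + artanh \<sigma>" by simp
      also have "\<dots> = ln (((1 + \<sigma>) / (1 - \<sigma>)) * ((1 + \<sigma>) / (1 - \<sigma>))) / 2"
        using pos by (subst ln_mult) (auto simp: artanh_def)
      also have "\<dots> \<le> ln (((1 + \<sigma>)\<^sup>2 - e\<^sup>2) / ((1 - \<sigma>)\<^sup>2 - e\<^sup>2)) / 2"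
      proof -
        have "(1 - \<sigma>)\<^sup>2 * e\<^sup>2 \<le> (1 + \<sigma>)\<^sup>2 * e\<^sup>2"
          using assms e by (intro mult_right_mono power_mono) auto
        then have "(1 + \<sigma>)\<^sup>2 / (1 - \<sigma>)\<^sup>2 \<le> ((1 + \<sigma>)\<^sup>2 - e\<^sup>2) / ((1 - \<sigma>)\<^sup>2 - e\<^sup>2)"
          using pos pos2 by (simp add: divide_le_eq pos_le_divide_eq algebra_simps)
        then show ?thesis
          using pos pos2 by (simp add: power2_eq_square)
      qed
      also have "((1 + \<sigma>)\<^sup>2 - e\<^sup>2) / ((1 - \<sigma>)\<^sup>2 - e\<^sup>2) = ((1 + (\<sigma> + e)) / (1 - (\<sigma> + e))) * ((1 + (\<sigma> - e)) / (1 - (\<sigma> - e)))"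
        by (simp flip: eq)
      also have "ln \<dots> / 2 = artanh (\<sigma> + e) + artanh (\<sigma> - e)"
        using pos by (subst ln_mult) (auto simp: artanh_def)
      finally show ?thesis .
    qed
    ultimately show "\<exists>D. (f has_real_derivative D) (at e) \<and> 0 \<le> D"
      by (metis diff_ge_0_iff_ge)
  qed
  then show ?thesis by (simp add: f_def)
qed

text \<open>\<open>dev\<close> is convex because its derivative artanh increases. Along one lattice
  step this yields the exponential decay used in the telescoping.\<close>

lemma dev_tangent:
  assumes "0 \<le> s" "s \<le> t" "t < 1"
  shows "dev s + (t - s) * artanh s \<le> dev t"
proof -
  define f where "f t = dev t - (t - s) * artanh s" for t
  have "f s \<le> f t"
  proof (rule DERIV_nonneg_imp_nondecreasing[OF assms(2)])
    fix y assume y: "s \<le> y" "y \<le> t"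
    have "(f has_real_derivative artanh y - artanh s) (at y)"
      unfolding f_def using y assms by (auto intro!: derivative_eq_intros)
    moreover have "artanh s \<le> artanh y"
    proof (rule DERIV_nonneg_imp_nondecreasing[OF y(1)])
      fix x assume x: "s \<le> x" "x \<le> y"
      then have "x\<^sup>2 < 1" using y assms by (simp add: abs_square_less_1)
      then show "\<exists>D. (artanh has_real_derivative D) (at x) \<and> 0 \<le> D"
        using x y assms by (intro exI[of _ "1 / (1 - x\<^sup>2)"] conjI artanh_real_has_field_derivative) auto
    qed
    ultimately show "\<exists>D. (f has_real_derivative D) (at y) \<and> 0 \<le> D"
      by (metis diff_ge_0_iff_ge)
  qed
  then show ?thesis by (simp add: f_def)
qed

lemma dev_ge: assumes "0 \<le> s" "s < 1" shows "s\<^sup>2 / 2 \<le> dev s"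
proof -
  define f where "f t = dev t - t\<^sup>2 / 2" for t
  have "f 0 \<le> f s"
  proof (rule DERIV_nonneg_imp_nondecreasing[OF assms(1)])
    fix y assume y: "0 \<le> y" "y \<le> s"
    have "(f has_real_derivative artanh y - y) (at y)"
      unfolding f_def using y assms by (auto intro!: derivative_eq_intros)
    moreover have "y \<le> artanh y"
      using artanh_ge[of y] y assms zero_le_power[of y 3] by linarith
    ultimately show "\<exists>D. (f has_real_derivative D) (at y) \<and> 0 \<le> D"
      by (metis diff_ge_0_iff_ge)
  qed
  then show ?thesis by (simp add: f_def)
qed

text \<open>The constant \<open>1/5\<close> is the one in the term \<open>z\<^sup>3 / 5\<close> of the theorem.\<close>

definition warp :: "real \<Rightarrow> real" where
  "warp s = s + s ^ 3 / 5"

lemma dev_le_warp: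
  assumes "0 \<le> s" "s < 1"
  shows "dev s \<le> (warp s)\<^sup>2 / 2"
proof -
  define A B where "A = s / (2 + s) + s ^ 3 / (12 * (2 + s) * (1 + s))"
    and "B = s / (2 - s) + s ^ 3 / (3 * (2 - s) ^ 3)"
  have nz: "2 + s > 0" "1 + s > 0" "2 - s > 0" using assms by auto
  have "(1 + s) * ln (1 + s) \<le> (1 + s) * (2 * A)"
  proof (rule mult_left_mono)
    have "2 * s / (2 + s) + s ^ 3 / (6 * (2 + s) * (1 + s)) = 2 * A"
      unfolding A_def using nz by (simp add: divide_simps, algebra)
    then show "ln (1 + s) \<le> 2 * A"
      using ln_one_plus_le[OF assms(1)] by simp
  qed (use assms in simp)
  moreover have "(1 - s) * ln (1 - s) \<le> (1 - s) * (- (2 * B))"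
    using ln_one_minus_le[of s] assms by (intro mult_left_mono) (auto simp: B_def)
  ultimately have "dev s \<le> (1 + s) * A - (1 - s) * B"
    by (simp add: dev_def)
  also have "\<dots> = s\<^sup>2 / 2 + s ^ 4 * (16 - 14 * s + 5 * s\<^sup>2) / (12 * ((2 + s) * (2 - s) ^ 3))"
    unfolding A_def B_def using nz by (simp add: divide_simps) algebra
  also have "\<dots> \<le> s\<^sup>2 / 2 + s ^ 4 / 5"
  proof -
    \<comment> \<open>In powers of \<open>v\<close> only the \<open>v ^ 4\<close> term has the wrong
      sign, and \<open>v\<^sup>2\<close> absorbs it. At \<open>s = 1\<close> the quotient to be
      bounded is 7/36, just below 1/5.\<close>
    define v where "v = 1 - s"
    have "0 \<le> v" "v \<le> 1" using assms by (auto simp: v_def)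
    then have "v ^ 4 \<le> v ^ 2" by (intro power_decreasing) auto
    then have "7 + 4 * v + 5 * v\<^sup>2 \<le> 12 / 5 * (3 + 8 * v + 6 * v\<^sup>2 - v ^ 4)"
      using \<open>0 \<le> v\<close> zero_le_power2[of v] by argo
    moreover have "16 - 14 * s + 5 * s\<^sup>2 = 7 + 4 * v + 5 * v\<^sup>2"
      unfolding v_def by algebra
    moreover have "(2 + s) * (2 - s) ^ 3 = 3 + 8 * v + 6 * v\<^sup>2 - v ^ 4"
      unfolding v_def by algebra
    ultimately have "16 - 14 * s + 5 * s\<^sup>2 \<le> 1 / 5 * (12 * ((2 + s) * (2 - s) ^ 3))"
      by simp
    then have "(16 - 14 * s + 5 * s\<^sup>2) / (12 * ((2 + s) * (2 - s) ^ 3)) \<le> 1 / 5"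
      using nz by (subst pos_divide_le_eq) auto
    then have "s ^ 4 * ((16 - 14 * s + 5 * s\<^sup>2) / (12 * ((2 + s) * (2 - s) ^ 3))) \<le> s ^ 4 * (1 / 5)"
      by (rule mult_left_mono) auto
    then show ?thesis by simp
  qed
  also have "\<dots> \<le> s\<^sup>2 / 2 + s ^ 4 / 5 + (s ^ 3)\<^sup>2 / 50" by simp
  also have "\<dots> = (warp s)\<^sup>2 / 2"
    unfolding warp_def by (simp add: field_simps) algebra
  finally show ?thesis .
qed

text \<open>Consecutive binomial weights have ratio \<open>exp (- 2 artanh \<sigma>)\<close> with \<open>\<sigma> = (2 j - n + 1) / (n + 1)\<close>.
  Since \<^const>\<open>artanh\<close> is the derivative of \<^const>\<open>dev\<close>, the midpoint rule makes the product telescope;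
  this is what forces the scaling by \<open>n + 1\<close> instead of \<open>n\<close>.\<close>

lemma bprob_central_ge':
  assumes "j = Suc n div 2"
  shows "sqrt (2 / (pi * (real n + 1))) * exp (- (real n + 1) * dev ((2 * real j - real n) / (real n + 1))) \<le> bprob n j"
proof (cases "even n")
  case True
  then obtain m where "n = 2 * m" by (elim evenE)
  then show ?thesis using assms bprob_central_ge[of m] by (simp add: add.commute)
next
  case False
  then obtain m where m: "n = Suc (2 * m)" by (elim oddE) auto
  define N where "N = real n + 1"
  have N: "N > 1" by (simp add: N_def m)
  have j: "j = Suc m" using assms m by simp
  \<comment> \<open>For odd \<open>n\<close> the central weight is that of the even row
    \<open>N\<close>, for which Wallis gives \<open>N + 1\<close> in place of \<open>N\<close>. As
    the argument of \<open>dev\<close> is \<open>1 / N\<close> and not 0, the exponential makes up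
    for the loss \<open>sqrt (N / (N + 1))\<close>.\<close>
  have "1 / (2 * N) \<le> N * dev (1 / N)"
    using dev_ge[of "1 / N"] N by (simp add: field_simps power2_eq_square)
  then have "exp (- N * dev (1 / N)) \<le> exp (- (1 / (2 * N)))" by simp
  also have "\<dots> = sqrt (inverse (exp (1 / N)))"
    by (intro real_sqrt_unique[symmetric]) (simp_all add: exp_minus[symmetric] power2_eq_square flip: exp_add)
  also have "\<dots> \<le> sqrt (N / (N + 1))"
  proof (rule real_sqrt_le_mono)
    have "(N + 1) / N \<le> exp (1 / N)"
      using exp_ge_add_one_self[of "1 / N"] N by (simp add: add_divide_distrib add.commute)
    then have "inverse (exp (1 / N)) \<le> inverse ((N + 1) / N)"
      using N by (intro le_imp_inverse_le) auto
    then show "inverse (exp (1 / N)) \<le> N / (N + 1)" by simp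
  qed
  finally have "sqrt (2 / (pi * N)) * exp (- N * dev (1 / N)) \<le> sqrt (2 / (pi * N)) * sqrt (N / (N + 1))"
    using N by (intro mult_left_mono) auto
  also have "\<dots> = sqrt (2 / (pi * (N + 1)))"
    using N by (simp flip: real_sqrt_mult)
  also have "\<dots> \<le> bprob n j"
    using bprob_central_ge[of "Suc m"] bprob_odd_central[of m] m j by (simp add: N_def add.commute)
  finally show ?thesis by (simp add: N_def m j)
qed

lemma bprob_ge:
  assumes "n \<le> 2 * j" "j \<le> n"
  shows "sqrt (2 / (pi * (real n + 1))) * exp (- (real n + 1) * dev ((2 * real j - real n) / (real n + 1))) \<le> bprob n j"
    (is "?L j \<le> _")
proof -
  define j0 where "j0 = Suc n div 2"
  have "j0 \<le> j" using assms by (auto simp: j0_def)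
  then show ?thesis using assms(2)
  proof (induction rule: dec_induct)
    case base
    show ?case by (rule bprob_central_ge') (rule j0_def)
  next
    case (step j)
    define N where "N = real n + 1"
    define \<sigma> where "\<sigma> = (2 * real j - real n + 1) / N"
    have N: "N > 0" by (simp add: N_def)
    have jn: "real n \<le> 2 * real j" "real j + 1 \<le> real n"
      using step by (auto simp: j0_def)
    have "2 * (1 / N) * artanh \<sigma> \<le> dev (\<sigma> + 1 / N) - dev (\<sigma> - 1 / N)"
      using jn N by (intro dev_midpoint) (auto simp: \<sigma>_def field_simps N_def)
    moreover have "\<sigma> + 1 / N = (2 * real (Suc j) - real n) / N" "\<sigma> - 1 / N = (2 * real j - real n) / N"
      by (simp_all add: \<sigma>_def diff_divide_distrib add_divide_distrib)
    ultimately have mid: "2 * artanh \<sigma> \<le> N * dev ((2 * real (Suc j) - real n) / N) - N * dev ((2 * real j - real n) / N)"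
      using N by (simp add: field_simps)
    have \<sigma>: "1 + \<sigma> = 2 * (real j + 1) / N" "1 - \<sigma> = 2 * (real n - real j) / N"
      using N by (simp_all add: \<sigma>_def field_simps) (simp_all add: N_def)
    have "(1 + \<sigma>) / (1 - \<sigma>) = (real j + 1) / (real n - real j)"
    proof -
      have "(2 * p / N) / (2 * q / N) = p / q" for p q using N by simp
      then show ?thesis unfolding \<sigma> .
    qed
    then have "exp (- 2 * artanh \<sigma>) = (real n - real j) / (real j + 1)"
      using jn by (simp add: artanh_def exp_minus)
    moreover have "bprob n (Suc j) = (real n - real j) / (real j + 1) * bprob n j"
      using bprob_Suc[of j n] by (simp add: nonzero_eq_divide_eq add.commute mult.commute)
    ultimately have ratio: "bprob n (Suc j) = exp (- 2 * artanh \<sigma>) * bprob n j" by simp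
    have "?L (Suc j) = sqrt (2 / (pi * N)) * exp (- N * dev ((2 * real (Suc j) - real n) / N))"
      by (simp add: N_def)
    also have "\<dots> \<le> sqrt (2 / (pi * N)) * exp (- 2 * artanh \<sigma> + - N * dev ((2 * real j - real n) / N))"
      using mid N by (intro mult_left_mono) auto
    also have "\<dots> = exp (- 2 * artanh \<sigma>) * ?L j"
      unfolding exp_add by (simp add: N_def)
    also have "\<dots> \<le> exp (- 2 * artanh \<sigma>) * bprob n j"
      using step by (intro mult_left_mono) auto
    finally show ?case by (simp add: ratio)
  qed
qed

text \<open>Here \<open>s\<close> and \<open>t = s + 2 / N\<close> are neighbouring lattice points
  and \<open>1 + 3 / 5 * t\<^sup>2\<close> is the slope of \<open>warp\<close> at \<open>t\<close>.
  The last two hypotheses are what \<open>2 / N \<le> s\<close> and \<open>t \<le> 1 - 1 / N\<close>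
  say without \<open>N\<close>.\<close>

lemma warp_slope_bound:
  fixes s t :: real
  assumes "0 \<le> s" "0 \<le> t" "t \<le> 2 * s" "3 * t \<le> 2 + s"
  shows "(1 + 3 / 5 * t\<^sup>2) * s \<le> (1 + s) * (s + s ^ 3 / 3)"
proof -
  have "3 / 5 * t\<^sup>2 \<le> s + s\<^sup>2 / 3 + s ^ 3 / 3"
  \<comment> \<open>The bounds \<open>2 * s\<close> and \<open>(2 + s) / 3\<close> on
    \<open>t\<close> cross at \<open>s = 2 / 5\<close>; the cut lies close to it, and each side uses
    the bound suited to it.\<close>
  proof (cases "s \<le> 9 / 20")
    case True
    have "t\<^sup>2 \<le> (2 * s)\<^sup>2" using assms by (intro power_mono) auto
    then have "t\<^sup>2 \<le> 4 * (s * s)" by (simp add: power2_eq_square)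
    moreover have "s * s \<le> 9 / 20 * s" using True assms by (intro mult_right_mono) auto
    moreover have "0 \<le> s ^ 3" using assms by simp
    ultimately show ?thesis using assms(1) unfolding power2_eq_square[of s] by linarith
  next
    case False
    have "t\<^sup>2 \<le> ((2 + s) / 3)\<^sup>2" using assms by (intro power_mono) auto
    then have "t\<^sup>2 \<le> 4 / 9 + 4 / 9 * s + s * s / 9" by (simp add: power2_eq_square field_simps)
    moreover have "9 / 20 * s \<le> s * s" using False assms by (intro mult_right_mono) auto
    moreover have "0 \<le> s ^ 3" using assms by simp
    ultimately show ?thesis using False unfolding power2_eq_square[of s] by argo
  qed
  then have "(1 + 3 / 5 * t\<^sup>2) * s \<le> (1 + (s + s\<^sup>2 / 3 + s ^ 3 / 3)) * s"
    using assms by (intro mult_right_mono) auto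
  also have "\<dots> = (1 + s) * (s + s ^ 3 / 3)"
    by (simp add: algebra_simps power2_eq_square power3_eq_cube)
  finally show ?thesis .
qed

text \<open>One step of the telescoping sum: the normal mass between consecutive warped lattice points is at
  most the lower bound on the binomial weight at the left one. The exponential decay of the density over
  the step gains a factor \<open>s / ((1 + s) artanh s)\<close>, which pays for the slope of \<^const>\<open>warp\<close>.\<close>

lemma Phi_warp_step:
  fixes N s :: real
  assumes N: "N > 0" and s: "2 / N \<le> s" "s + 2 / N \<le> 1 - 1 / N"
  shows "Phi (sqrt N * warp (s + 2 / N)) - Phi (sqrt N * warp s)
           \<le> sqrt (2 / (pi * N)) * exp (- N * dev s)"
proof -
  define a where "a = artanh s"
  define C where "C = sqrt (2 / (pi * N)) * exp (- N * dev s)"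
  define K where "K = 1 + 3 / 5 * (s + 2 / N)\<^sup>2"
  \<comment> \<open>The first term is the integral of \<open>C * K * exp (- 2 * a * t)\<close>,
    which dominates the derivative of the second along the step, so \<open>f 0 \<le> f 1\<close> is
    the integrated comparison.\<close>
  define f where "f t = C * K * (1 - exp (- 2 * a * t)) / (2 * a) - Phi (sqrt N * warp (s + 2 * t / N))" for t
  have inv: "0 < 1 / N" "2 / N = 2 * (1 / N)" using N by simp_all
  then have s01: "0 < s" "s < 1" "s + 2 / N < 1" using s by linarith+
  have a: "s + s ^ 3 / 3 \<le> a" "a > 0"
    using artanh_ge[of s] s01 zero_less_power[OF s01(1), of 3] unfolding a_def by linarith+
  have "f 0 \<le> f 1"
  proof (rule DERIV_nonneg_imp_nondecreasing[where f = f and a = 0 and b = 1])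
    fix t :: real assume t: "0 \<le> t" "t \<le> 1"
    define x where "x = s + 2 * t / N"
    have "2 * t / N \<le> 2 / N" using t N by (intro divide_right_mono) auto
    then have x: "s \<le> x" "x \<le> s + 2 / N" using t N by (auto simp: x_def)
    have "(f has_real_derivative C * K * exp (- 2 * a * t)
        - std_normal_density (sqrt N * warp x) * (sqrt N * ((1 + 3 / 5 * x\<^sup>2) * (2 / N)))) (at t)"
      unfolding f_def warp_def x_def using a N
      by (auto intro!: derivative_eq_intros simp: algebra_simps)
    moreover have "std_normal_density (sqrt N * warp x) * (sqrt N * ((1 + 3 / 5 * x\<^sup>2) * (2 / N)))
        \<le> C * K * exp (- 2 * a * t)"
    proof -
      have "N * dev s + 2 * a * t = N * (dev s + (x - s) * artanh s)"
        using N by (simp add: x_def a_def field_simps)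
      also have "\<dots> \<le> N * dev x"
        using dev_tangent[of s x] x s01 N by (intro mult_left_mono) auto
      also have "\<dots> \<le> N * ((warp x)\<^sup>2 / 2)"
        using dev_le_warp[of x] x s01 N by (intro mult_left_mono) auto
      finally have "N * dev s + 2 * a * t \<le> (sqrt N * warp x)\<^sup>2 / 2"
        using N by (simp add: power_mult_distrib)
      then have "exp (- (sqrt N * warp x)\<^sup>2 / 2) \<le> exp (- N * dev s) * exp (- 2 * a * t)"
        by (simp flip: exp_add)
      then have "std_normal_density (sqrt N * warp x) \<le> (1 / sqrt (2 * pi)) * (exp (- N * dev s) * exp (- 2 * a * t))"
        unfolding std_normal_density_def by (intro mult_left_mono) auto
      moreover have "1 + 3 / 5 * x\<^sup>2 \<le> K"
        using x s01 unfolding K_def by (intro add_left_mono mult_left_mono power_mono) auto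
      moreover have "0 \<le> K" by (simp add: K_def)
      ultimately have "std_normal_density (sqrt N * warp x) * (sqrt N * ((1 + 3 / 5 * x\<^sup>2) * (2 / N)))
        \<le> (1 / sqrt (2 * pi)) * (exp (- N * dev s) * exp (- 2 * a * t)) * (sqrt N * (K * (2 / N)))"
        using N by (intro mult_mono) (auto intro!: mult_right_mono mult_left_mono)
      also have "\<dots> = (1 / sqrt (2 * pi) * sqrt N * (2 / N)) * exp (- N * dev s) * K * exp (- 2 * a * t)"
        by (simp only: ac_simps)
      also have "1 / sqrt (2 * pi) * sqrt N * (2 / N) = sqrt (2 / (pi * N))"
        using N by (intro real_sqrt_unique[symmetric])
          (auto simp: power_mult_distrib power_divide power2_eq_square[of N] field_simps)
      finally show ?thesis by (simp add: C_def)
    qed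
    ultimately show "\<exists>D. (f has_real_derivative D) (at t) \<and> 0 \<le> D"
      by (metis diff_ge_0_iff_ge)
  qed simp
  then have "Phi (sqrt N * warp (s + 2 / N)) - Phi (sqrt N * warp s) \<le> C * (K * ((1 - exp (- 2 * a)) / (2 * a)))"
    by (simp add: f_def)
  also have "\<dots> \<le> C * 1"
  proof (rule mult_left_mono)
    have "exp (- 2 * a) = (1 - s) / (1 + s)"
      using s01 by (simp add: a_def artanh_def exp_minus)
    then have "1 - exp (- 2 * a) = 2 * s / (1 + s)"
      using s01 by (simp add: field_simps)
    then have "(1 - exp (- 2 * a)) / (2 * a) = s / ((1 + s) * a)"
      by simp
    moreover have "K * s \<le> (1 + s) * (s + s ^ 3 / 3)"
      unfolding K_def by (rule warp_slope_bound) (use s s01 inv in \<open>linarith | argo\<close>)+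
    then have "K * s \<le> (1 + s) * a"
      using mult_left_mono[OF a(1), of "1 + s"] s01 by linarith
    ultimately show "K * ((1 - exp (- 2 * a)) / (2 * a)) \<le> 1"
      using s01 a by (simp add: divide_le_eq)
  qed (use N in \<open>simp add: C_def\<close>)
  finally show ?thesis by (simp add: C_def)
qed

text \<open>The start of the telescoping, at \<open>j = n\<close>, where the binomial tail is the
  single weight \<open>1 / 2 ^ n\<close>. Mills' ratio with \<open>v \<ge> 1\<close> reduces it to a
  lower bound on \<open>v\<^sup>2 / 2\<close> that is linear in \<open>N\<close>.\<close>

lemma Phi_warp_top:
  assumes n: "n \<ge> 2"
  shows "1 - Phi (sqrt (real n + 1) * warp (real n / (real n + 1))) \<le> 1 / 2 ^ n"
proof -
  define N x where "N = real n + 1" and "x = 1 / (real n + 1)"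
  define v where "v = sqrt N * warp (1 - x)"
  have N: "N \<ge> 3" "N * x = 1" using n by (auto simp: N_def x_def)
  have x: "0 < x" "x \<le> 1 / 3" using n by (auto simp: x_def field_simps)
  have s: "real n / (real n + 1) = 1 - x" by (simp add: x_def field_simps)
  have v2: "v\<^sup>2 = N * (warp (1 - x))\<^sup>2" using N by (simp add: v_def power_mult_distrib)
  have w: "(warp (1 - x))\<^sup>2 / 2 \<ge> 18 / 25 - 48 / 25 * x + 8 / 5 * x\<^sup>2"
  proof -
    have "(warp (1 - x))\<^sup>2 / 2 - (18 / 25 - 48 / 25 * x + 2 * x\<^sup>2 - 6 / 5 * x ^ 3)
        = x ^ 4 / 5 + (x ^ 4 * (15 - 6 * x + x\<^sup>2)) / 50"
      unfolding warp_def by (simp add: field_simps) algebra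
    also have "\<dots> \<ge> 0" using x by (intro add_nonneg_nonneg divide_nonneg_pos mult_nonneg_nonneg) auto
    moreover have "x\<^sup>2 * x \<le> x\<^sup>2 * (1 / 3)" using x by (intro mult_left_mono) auto
    then have "6 / 5 * x ^ 3 \<le> 2 / 5 * x\<^sup>2" by (simp add: power2_eq_square power3_eq_cube)
    ultimately show ?thesis by linarith
  qed
  \<comment> \<open>25/36 is an upper bound for ln 2, \<open>N - 2\<close> is \<open>n - 1\<close>,
    and -1/5 bounds \<open>ln (4 / 5)\<close>, where 4/5 is twice the prefactor 2/5 of the density
    bound. The slope 18/25 barely exceeds 25/36, so the \<open>x\<close> term must help for small
    \<open>N\<close>; the square below balances \<open>N\<close> against
    \<open>1 / N\<close>.\<close>
  have "(N - 2) * (25 / 36) - 1 / 5 \<le> N * (18 / 25 - 48 / 25 * x + 8 / 5 * x\<^sup>2)"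
  proof -
    have "0 \<le> (N - 13 / 2)\<^sup>2 * x" using x by simp
    also have "\<dots> = N * (N * x) - 13 * (N * x) + 169 / 4 * x" by (simp add: power2_eq_square algebra_simps)
    finally have "13 \<le> N + 169 / 4 * x" by (simp add: N)
    moreover have "N * (18 / 25 - 48 / 25 * x + 8 / 5 * x\<^sup>2) = 18 / 25 * N - 48 / 25 * (N * x) + 8 / 5 * (N * x) * x"
      by (simp add: power2_eq_square algebra_simps)
    then have "N * (18 / 25 - 48 / 25 * x + 8 / 5 * x\<^sup>2) = 18 / 25 * N - 48 / 25 + 8 / 5 * x"
      unfolding N by simp
    ultimately show ?thesis using x by (simp only:) argo
  qed
  also have "\<dots> \<le> v\<^sup>2 / 2"
    using mult_left_mono[OF w, of N] N by (simp add: v2)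
  finally have v2_ge: "(N - 2) * (25 / 36) - 1 / 5 \<le> v\<^sup>2 / 2" .
  have "N * (1 - x) \<ge> 2" using N by (simp add: algebra_simps)
  have "1 \<le> N * (1 - x)\<^sup>2"
  proof -
    have "2 * (2 / 3) \<le> (N * (1 - x)) * (1 - x)"
      using \<open>N * (1 - x) \<ge> 2\<close> x by (intro mult_mono) auto
    then show ?thesis by (simp add: power2_eq_square)
  qed
  also have "\<dots> \<le> v\<^sup>2"
    unfolding v2 using N x by (intro mult_left_mono power_mono) (auto simp: warp_def)
  finally have "1 \<le> v\<^sup>2" .
  moreover have "0 \<le> v" using x N by (auto simp: v_def warp_def)
  ultimately have v1: "1 \<le> v" using power2_le_imp_le[of 1 v] by simp
  have "1 - Phi v \<le> std_normal_density v / v"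
    using v1 by (intro Mills_ratio_upper) auto
  also have "\<dots> \<le> std_normal_density v / 1"
    using v1 by (intro divide_left_mono) auto
  also have "\<dots> \<le> 2 / 5 * exp (- v\<^sup>2 / 2)"
  proof -
    have "5 / 2 \<le> sqrt (2 * pi)"
      using pi_approx by (intro real_le_rsqrt) (simp add: power2_eq_square)
    then have "1 / sqrt (2 * pi) \<le> 2 / 5"
      by (simp add: field_simps)
    then show ?thesis
      using mult_right_mono[of "1 / sqrt (2 * pi)" "2 / 5" "exp (- v\<^sup>2 / 2)"]
      unfolding std_normal_density_def by simp
  qed
  also have "\<dots> \<le> 1 / 2 ^ n"
  proof -
    have "ln (4 / 5) \<le> (4 / 5 :: real) - 1" by (rule ln_le_minus_one) simp
    have "real (n - 1) * ln 2 \<le> real (n - 1) * (25 / 36)"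
      using ln2_le_25_over_36 by (intro mult_left_mono) auto
    then have "(real n - 1) * ln 2 \<le> (N - 2) * (25 / 36)"
      using n by (simp add: N_def of_nat_diff)
    then have "ln (4 / 5) + - v\<^sup>2 / 2 \<le> - ((real n - 1) * ln 2)"
      using v2_ge \<open>ln (4 / 5) \<le> _\<close> by linarith
    then have "exp (ln (4 / 5) + - v\<^sup>2 / 2) \<le> exp (- ((real n - 1) * ln 2))" by simp
    also have "\<dots> = exp (ln 2 + - real n * ln 2)" by (simp add: algebra_simps)
    also have "\<dots> = 2 / 2 ^ n"
      unfolding exp_add by (simp add: exp_minus exp_of_nat_mult field_simps)
    finally show ?thesis unfolding exp_add by simp
  qed
  finally show ?thesis by (simp add: v_def s N_def)
qed

text \<open>Downward induction from \<open>j = n\<close>: each step adds one binomial weight, which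
  covers the normal mass between two warped lattice points. The hypothesis
  \<open>n + 2 \<le> 2 * j\<close> provides \<open>2 / N \<le> s\<close>.\<close>

lemma btail_ge_Phi:
  assumes "n + 2 \<le> 2 * j" "j \<le> n"
  shows "1 - Phi (sqrt (real n + 1) * warp ((2 * real j - real n) / (real n + 1))) \<le> btail n j"
  using assms(2,1)
proof (induction rule: inc_induct)
  case base
  then show ?case using Phi_warp_top[of n] by (simp add: btail_top)
next
  case (step j)
  define N s where "N = real n + 1" and "s = (2 * real j - real n) / N"
  have N: "N > 0" by (simp add: N_def)
  have r: "real n + 2 \<le> 2 * real j" "real j + 1 \<le> real n" using step by auto
  have "Phi (sqrt N * warp (s + 2 / N)) - Phi (sqrt N * warp s)
           \<le> sqrt (2 / (pi * N)) * exp (- N * dev s)"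
  proof (rule Phi_warp_step[OF N])
    show "2 / N \<le> s" unfolding s_def using r N by (intro divide_right_mono) auto
    have "s + 2 / N = (2 * real j - real n + 2) / N" by (simp add: s_def add_divide_distrib)
    also have "\<dots> \<le> real n / N" using r N by (intro divide_right_mono) auto
    also have "\<dots> = 1 - 1 / N" using N by (simp add: field_simps) (simp add: N_def)
    finally show "s + 2 / N \<le> 1 - 1 / N" .
  qed
  also have "\<dots> \<le> bprob n j"
    using bprob_ge[of n j] step by (simp add: N_def s_def)
  finally have "1 - Phi (sqrt N * warp s) \<le> bprob n j + (1 - Phi (sqrt N * warp (s + 2 / N)))"
    by simp
  also have "s + 2 / N = (2 * real (Suc j) - real n) / N"
    by (simp add: s_def flip: add_divide_distrib)
  also have "bprob n j + (1 - Phi (sqrt N * warp ((2 * real (Suc j) - real n) / N))) \<le> btail n j"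
    using step by (simp add: N_def btail_Suc[of n j])
  finally show ?case by (simp add: N_def s_def)
qed

section \<open>Counting and order statistics\<close>

text \<open>In a sorted list the entries at most \<open>t\<close> form a prefix, so their number is
  decided by a single entry; positions are 0-based, ranks 1-based.\<close>

lemma sorted_length_filter_le_iff:
  fixes ys :: "'a :: linorder list"
  assumes "sorted ys" "1 \<le> k" "k \<le> length ys"
  shows "k \<le> length (filter (\<lambda>y. y \<le> t) ys) \<longleftrightarrow> ys ! (k - 1) \<le> t"
proof
  have len: "length (filter (\<lambda>y. y \<le> t) ys) = card {i. i < length ys \<and> ys ! i \<le> t}"
    by (rule length_filter_conv_card)
  show "ys ! (k - 1) \<le> t" if "k \<le> length (filter (\<lambda>y. y \<le> t) ys)"
  proof (rule ccontr)
    assume *: "\<not> ys ! (k - 1) \<le> t"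
    have "i < k - 1" if "i < length ys" "ys ! i \<le> t" for i
    proof (rule ccontr)
      assume "\<not> i < k - 1"
      then have "ys ! (k - 1) \<le> ys ! i"
        using assms that by (intro sorted_nth_mono) auto
      then show False using * that by simp
    qed
    then have "card {i. i < length ys \<and> ys ! i \<le> t} \<le> card {..<k - 1}"
      by (intro card_mono) auto
    then show False using that len assms by simp
  qed
  show "k \<le> length (filter (\<lambda>y. y \<le> t) ys)" if "ys ! (k - 1) \<le> t"
  proof -
    have "ys ! i \<le> t" if "i < k" for i
      by (rule order_trans[OF sorted_nth_mono[OF assms(1), of i "k - 1"] \<open>ys ! (k - 1) \<le> t\<close>])
         (use that assms in auto)
    then have "card {..<k} \<le> card {i. i < length ys \<and> ys ! i \<le> t}"
      using assms by (intro card_mono) auto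
    then show ?thesis using len by simp
  qed
qed

lemma sum_of_bool_length_filter:
  "(\<Sum>i=1..n. of_bool (P (x i))) = int (length (filter P (sort (map x [1..<Suc n]))))"
proof -
  have "length (filter P (sort (map x [1..<Suc n]))) = length (filter P (map x [1..<Suc n]))"
    by (metis mset_filter mset_sort size_mset)
  also have "int \<dots> = (\<Sum>i\<leftarrow>[1..<Suc n]. of_bool (P (x i)))"
    by (induction n) auto
  also have "\<dots> = (\<Sum>i=1..n. of_bool (P (x i)))"
    by (simp only: sum_list_distinct_conv_sum_set distinct_upt set_upt atLeastLessThanSuc_atLeastAtMost)
  finally show ?thesis by simp
qed

lemma count_le_iff_order_stat:
  assumes "1 \<le> k" "k \<le> n"
  shows "int k \<le> (\<Sum>i=1..n. of_bool (x i \<le> t)) \<longleftrightarrow> order_stat n x k \<le> t"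
  using sorted_length_filter_le_iff[of "sort (map x [1..<Suc n])" k t] assms
  by (simp only: sum_of_bool_length_filter[of "\<lambda>y. y \<le> t"] order_stat_def of_nat_le_iff sorted_sort length_sort length_map length_upt diff_Suc_1)

text \<open>At least \<open>k\<close> of the values are \<open>\<ge> t\<close> unless \<open>n - k + 1\<close> of them are \<open>< t\<close>.\<close>

lemma count_ge_iff_order_stat:
  assumes "1 \<le> k" "k \<le> n"
  shows "int k \<le> (\<Sum>i=1..n. of_bool (x i \<ge> t)) \<longleftrightarrow> t \<le> order_stat n x (Suc n - k)"
proof -
  define ys where "ys = sort (map x [1..<Suc n])"
  have ys: "sorted ys" "length ys = n" by (simp_all add: ys_def)
  have len: "length (filter (\<lambda>y. t \<le> y) ys) = card {i. i < n \<and> t \<le> ys ! i}"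
    using ys by (simp add: length_filter_conv_card)
  have "k \<le> card {i. i < n \<and> t \<le> ys ! i} \<longleftrightarrow> t \<le> ys ! (n - k)"
  proof
    assume *: "k \<le> card {i. i < n \<and> t \<le> ys ! i}"
    show "t \<le> ys ! (n - k)"
    proof (rule ccontr)
      assume **: "\<not> t \<le> ys ! (n - k)"
      have "n - k < i" if "i < n" "t \<le> ys ! i" for i
        using sorted_nth_mono[OF ys(1), of i "n - k"] that ** assms ys(2) by (cases "n - k < i") auto
      then have "card {i. i < n \<and> t \<le> ys ! i} \<le> card {n - k<..<n}"
        by (intro card_mono) auto
      then show False using * assms by simp
    qed
  next
    assume *: "t \<le> ys ! (n - k)"
    have "t \<le> ys ! i" if "n - k \<le> i" "i < n" for i
      using sorted_nth_mono[OF ys(1), of "n - k" i] that * ys(2) by auto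
    then have "card {n - k..<n} \<le> card {i. i < n \<and> t \<le> ys ! i}"
      by (intro card_mono) auto
    then show "k \<le> card {i. i < n \<and> t \<le> ys ! i}" using assms by simp
  qed
  then show ?thesis
    using assms unfolding sum_of_bool_length_filter[of "\<lambda>y. t \<le> y"] order_stat_def ys_def[symmetric] len by (simp add: Suc_diff_le)
qed

text \<open>Links the real-valued count, suited to measurability and independence, to the integer
  count in \<open>CI1\<close> and \<open>CI2\<close>.\<close>

lemma sum_of_bool_le_iff:
  "real k \<le> (\<Sum>i=1..n. of_bool (P i)) \<longleftrightarrow> int k \<le> (\<Sum>i=1..n. of_bool (P i))"
proof -
  have "(\<Sum>i=1..n. of_bool (P i)) = real_of_int (\<Sum>i=1..n. of_bool (P i))" by simp
  then show ?thesis by linarith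
qed

text \<open>Induction on the number of variables, conditioning on the last one. The resulting
  mixture is nondecreasing in its success probability \<open>p\<close>, and at
  \<open>p = 1/2\<close> it obeys the recursion \<open>btail_Suc_Suc\<close>.\<close>

lemma (in prob_space) btail_le_prob_count:
  fixes X :: "nat \<Rightarrow> 'a \<Rightarrow> real"
  assumes "indep_vars (\<lambda>_. borel) X {1..n}"
    and "A \<in> sets borel" "\<And>i. i \<in> {1..n} \<Longrightarrow> prob {\<omega> \<in> space M. X i \<omega> \<in> A} \<ge> 1/2"
  shows "btail n k \<le> prob {\<omega> \<in> space M. int k \<le> (\<Sum>i=1..n. of_bool (X i \<omega> \<in> A))}"
proof -
  define S where "S m \<omega> = (\<Sum>i=1..m. of_bool (X i \<omega> \<in> A) :: real)" for m \<omega>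
  define Z where "Z i \<omega> = (of_bool (X i \<omega> \<in> A) :: real)" for i \<omega>
  have meas_X: "X i \<in> borel_measurable M" if "i \<in> {1..n}" for i
    using assms(1) that by (auto simp: indep_vars_def)
  have indep_Z: "indep_vars (\<lambda>_. borel) Z {1..n}"
    unfolding Z_def using assms(2) by (intro indep_vars_compose2[OF assms(1), where Y="\<lambda>_ x. of_bool (x \<in> A)"]) auto
  have S: "S m = (\<lambda>\<omega>. \<Sum>i=1..m. Z i \<omega>)" for m
    by (simp add: S_def Z_def fun_eq_iff)
  have meas_S: "S m \<in> borel_measurable M" if "m \<le> n" for m
    unfolding S using that indep_Z by (intro borel_measurable_sum) (auto simp: indep_vars_def)
  have main: "btail m k \<le> prob {\<omega> \<in> space M. real k \<le> S m \<omega>}" if "m \<le> n" for m k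
    using that
  proof (induction m arbitrary: k)
    case 0
    show ?case
    proof (cases "k = 0")
      case True
      then show ?thesis by (simp add: S_def btail_0 prob_space)
    qed (simp add: btail_eq_0)
  next
    case (Suc m)
    show ?case
    proof (cases k)
      case 0
      then have "{\<omega> \<in> space M. real k \<le> S (Suc m) \<omega>} = space M"
        by (auto simp: S_def intro: sum_nonneg)
      then show ?thesis by (simp add: 0 btail_0 prob_space)
    next
      case (Suc k')
      define p where "p = prob {\<omega> \<in> space M. X (Suc m) \<omega> \<in> A}"
      define q where "q j = prob {\<omega> \<in> space M. real j \<le> S m \<omega>}" for j :: nat
      have [measurable]: "S m \<in> borel_measurable M" "X (Suc m) \<in> borel_measurable M" "A \<in> sets borel"
        using meas_S[of m] meas_X[of "Suc m"] Suc.prems assms(2) by auto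
      have "indep_var borel (Z (Suc m)) borel (\<lambda>\<omega>. \<Sum>i\<in>{1..m}. Z i \<omega>)"
        using Suc.prems by (intro indep_vars_sum indep_vars_subset[OF indep_Z]) auto
      then have ind: "indep_var borel (Z (Suc m)) borel (S m)"
        by (simp add: S)
      have prod: "prob {\<omega> \<in> space M. Z (Suc m) \<omega> \<in> B \<and> S m \<omega> \<in> C}
          = prob {\<omega> \<in> space M. Z (Suc m) \<omega> \<in> B} * prob {\<omega> \<in> space M. S m \<omega> \<in> C}"
        if "B \<in> sets borel" "C \<in> sets borel" for B C
        using indep_varD[OF ind that] by (simp add: vimage_def Int_def conj_ac)
      have p_compl: "prob {\<omega> \<in> space M. X (Suc m) \<omega> \<notin> A} = 1 - p"
        unfolding p_def by (subst prob_neg) auto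
      have 1: "prob {\<omega> \<in> space M. X (Suc m) \<omega> \<in> A \<and> real k' \<le> S m \<omega>} = p * q k'"
        using prod[of "{1}" "{real k'..}"] by (simp add: Z_def p_def q_def)
      have 2: "prob {\<omega> \<in> space M. X (Suc m) \<omega> \<notin> A \<and> real (Suc k') \<le> S m \<omega>} = (1 - p) * q (Suc k')"
        using prod[of "{0}" "{real (Suc k')..}"] by (simp add: Z_def p_compl q_def)
      have "{\<omega> \<in> space M. real k \<le> S (Suc m) \<omega>}
          = {\<omega> \<in> space M. X (Suc m) \<omega> \<in> A \<and> real k' \<le> S m \<omega>} \<union> {\<omega> \<in> space M. X (Suc m) \<omega> \<notin> A \<and> real (Suc k') \<le> S m \<omega>}"
        by (auto simp: Suc S_def)
      then have "prob {\<omega> \<in> space M. real k \<le> S (Suc m) \<omega>} = p * q k' + (1 - p) * q (Suc k')"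
        by (simp only:) (subst finite_measure_Union; auto simp: 1[simplified] 2[simplified])
      also have "\<dots> = (q k' + q (Suc k')) / 2 + (p - 1 / 2) * (q k' - q (Suc k'))"
        by (simp add: field_simps)
      also have "\<dots> \<ge> (q k' + q (Suc k')) / 2"
      proof -
        have "q (Suc k') \<le> q k'"
          unfolding q_def by (intro finite_measure_mono) auto
        moreover have "1 / 2 \<le> p" using assms(3)[of "Suc m"] Suc.prems by (simp add: p_def)
        ultimately show ?thesis by simp
      qed
      finally have "(q k' + q (Suc k')) / 2 \<le> prob {\<omega> \<in> space M. real k \<le> S (Suc m) \<omega>}" .
      moreover have "btail m k' \<le> q k'" "btail m (Suc k') \<le> q (Suc k')"
        using Suc.IH[of k'] Suc.IH[of "Suc k'"] Suc.prems unfolding q_def by simp_all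
      ultimately show ?thesis by (simp add: Suc btail_Suc_Suc)
    qed
  qed
  from main[of n k] show ?thesis
    by (simp only: S_def sum_of_bool_le_iff order_refl)
qed

section \<open>The confidence set\<close>

lemma c_crit_le:
  assumes n: "n \<ge> 1" and \<alpha>: "0 < \<alpha>" "\<alpha> < 1"
  shows "real_of_int (c_crit n \<alpha>) \<le> sqrt (real n) * z_upper (\<alpha> / 2) / 2 + 1"
proof -
  define z where "z = z_upper (\<alpha> / 2)"
  have Phi_z: "Phi z = 1 - \<alpha> / 2" unfolding z_def using \<alpha> by (intro Phi_z_upper) auto
  then have "Phi 0 < Phi z" using \<alpha> by (simp add: Phi_0)
  then have "z > 0" by (metis Phi_le_iff linorder_not_less)
  obtain c where c: "c_crit n \<alpha> = int c" "\<And>x. btail n (upper_rank n + x) \<le> \<alpha> / 2 \<longleftrightarrow> c \<le> x"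
    using c_crit[OF \<alpha>] by blast
  \<comment> \<open>Rounding up costs the constant 1 of the bound and ensures
    \<open>x \<ge> 1\<close>, as \<open>btail_le_Phi\<close> requires.\<close>
  define x where "x = nat \<lfloor>sqrt (real n) * z / 2\<rfloor> + 1"
  have x: "sqrt (real n) * z / 2 \<le> real x" "real x \<le> sqrt (real n) * z / 2 + 1"
    using \<open>z > 0\<close> unfolding x_def by (simp_all, linarith+)
  have "btail n (upper_rank n + x) \<le> 1 - Phi (2 * real x / sqrt (real n))"
    using n by (intro btail_le_Phi) (auto simp: x_def)
  also have "\<dots> \<le> 1 - Phi z"
    using x n by (simp add: Phi_le_iff field_simps)
  finally have "c \<le> x" using c Phi_z by simp
  then show ?thesis using x c by (simp add: z_def)
qed

text \<open>At \<open>j = upper_rank n + c\<close> the tail is at most \<alpha>/2, the normal tail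
  at \<open>z\<close>, so \<open>btail_ge_Phi\<close> bounds \<open>z\<close> by a cubic in
  \<open>y = 2 * j - n\<close>. The hypothesis \<open>top\<close> keeps
  \<open>j \<le> n\<close>.\<close>

lemma le_c_crit:
  assumes \<alpha>: "0 < \<alpha>" "\<alpha> < 1" and top: "c_crit n \<alpha> < int (n div 2)"
  shows "sqrt (real n) * z_upper (\<alpha> / 2) / 2 - z_upper (\<alpha> / 2) ^ 3 / (10 * sqrt (real n)) - 3 / 2
      \<le> real_of_int (c_crit n \<alpha>)"
proof -
  define z where "z = z_upper (\<alpha> / 2)"
  have Phi_z: "Phi z = 1 - \<alpha> / 2" unfolding z_def using \<alpha> by (intro Phi_z_upper) auto
  obtain c where c: "c_crit n \<alpha> = int c" "\<And>x. btail n (upper_rank n + x) \<le> \<alpha> / 2 \<longleftrightarrow> c \<le> x"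
    using c_crit[OF \<alpha>] by blast
  define j where "j = upper_rank n + c"
  define N y where "N = real n + 1" and "y = 2 * real j - real n"
  have cn: "c < n div 2" using top c by simp
  then have n: "real n > 0" "n > 0" by (auto intro: gr0I)
  \<comment> \<open>The 3 is attained for odd \<open>n\<close> (it would be 2 for even
    \<open>n\<close>); halved, it is the 3/2 of the bound.\<close>
  have j: "j \<le> n" "n + 2 \<le> 2 * j" "2 * j \<le> n + 2 * c + 3"
    using cn by (auto simp: j_def upper_rank_def)
  have y: "0 \<le> y" "y \<le> 2 * real c + 3" using j by (auto simp: y_def)
  have "1 - Phi (sqrt N * warp (y / N)) \<le> btail n j"
    unfolding N_def y_def using j by (intro btail_ge_Phi)
  also have "\<dots> \<le> 1 - Phi z" using c Phi_z by (simp add: j_def)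
  finally have "z \<le> sqrt N * warp (y / N)" by (simp add: Phi_le_iff)
  also have "\<dots> = y / sqrt N + (y / sqrt N) ^ 3 / (5 * N)"
  proof -
    have *: "sqrt N * sqrt N = N" "sqrt N \<noteq> 0" using n by (auto simp: N_def)
    define r where "r = sqrt N"
    have "r * (y / (r * r) + (y / (r * r)) ^ 3 / 5) = y / r + (y / r) ^ 3 / (5 * (r * r))" if "r \<noteq> 0"
      using that by (simp add: divide_simps) algebra
    then show ?thesis using * by (simp add: warp_def r_def)
  qed
  also have "\<dots> \<le> y / sqrt (real n) + (y / sqrt (real n)) ^ 3 / (5 * real n)"
    using n y by (intro add_mono frac_le power_mono divide_left_mono) (auto simp: N_def)
  finally have z: "z \<le> y / sqrt (real n) + (y / sqrt (real n)) ^ 3 / (5 * real n)" .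
  \<comment> \<open>Inverts the cubic: either \<open>z\<close> is already at most
    \<open>y / sqrt (real n)\<close>, or it is larger and may replace it in the cubic term.\<close>
  have "z - z ^ 3 / (5 * real n) \<le> y / sqrt (real n)"
  proof (cases "z \<le> y / sqrt (real n)")
    case True
    have "Phi 0 \<le> Phi z" using \<alpha> Phi_z by (simp add: Phi_0)
    then have "0 \<le> z ^ 3 / (5 * real n)" by (simp add: Phi_le_iff)
    then show ?thesis using True by simp
  next
    case False
    then have "(y / sqrt (real n)) ^ 3 / (5 * real n) \<le> z ^ 3 / (5 * real n)"
      using y by (intro divide_right_mono power_mono) auto
    then show ?thesis using z by simp
  qed
  then have "sqrt (real n) / 2 * (z - z ^ 3 / (5 * real n)) \<le> sqrt (real n) / 2 * (y / sqrt (real n))"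
    by (rule mult_left_mono) simp
  also have "sqrt (real n) / 2 * (y / sqrt (real n)) = y / 2" using n by simp
  also have "sqrt (real n) / 2 * (z - z ^ 3 / (5 * real n)) = sqrt (real n) * z / 2 - z ^ 3 / (10 * sqrt (real n))"
  proof -
    have "sqrt (real n) / (10 * real n) = 1 / (10 * sqrt (real n))"
      using n by (simp add: field_simps)
    then have "z ^ 3 * (sqrt (real n) / (10 * real n)) = z ^ 3 * (1 / (10 * sqrt (real n)))" by simp
    then show ?thesis by (simp add: algebra_simps)
  qed
  finally show ?thesis using y c by (simp add: z_def)
qed

text \<open>Both sides say that the last weight \<open>1 / 2 ^ n\<close> is at most \<alpha>/2: for
  \<open>n \<ge> 2\<close> the tail consisting of it alone starts at
  \<open>upper_rank n + (n div 2 - 1)\<close>. For \<open>n = 1\<close> both sides are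
  false.\<close>

lemma log_le_iff_c_crit:
  assumes n: "n \<ge> 1" and \<alpha>: "0 < \<alpha>" "\<alpha> < 1"
  shows "log 2 (2 / \<alpha>) \<le> real n \<longleftrightarrow> c_crit n \<alpha> < int (n div 2)"
proof -
  obtain c where c: "c_crit n \<alpha> = int c" "c \<le> n div 2" "\<And>x. btail n (upper_rank n + x) \<le> \<alpha> / 2 \<longleftrightarrow> c \<le> x"
    using c_crit[OF \<alpha>] by blast
  have "log 2 (2 / \<alpha>) \<le> real n \<longleftrightarrow> 2 / \<alpha> \<le> 2 ^ n"
    using \<alpha> by (simp add: log_le_iff powr_realpow)
  also have "\<dots> \<longleftrightarrow> btail n n \<le> \<alpha> / 2"
    using \<alpha> by (simp add: btail_top field_simps)
  also have "\<dots> \<longleftrightarrow> c < n div 2"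
  proof (cases "n = 1")
    case True
    then show ?thesis using \<alpha> by (simp add: btail_top)
  next
    case False
    then have "n = upper_rank n + (n div 2 - 1)" "n div 2 \<ge> 1" using n by (auto simp: upper_rank_def)
    then show ?thesis using c(3)[of "n div 2 - 1"] by auto
  qed
  finally show ?thesis using c by simp
qed

text \<open>The count threshold \<open>k\<close> is positive exactly in the logarithmic case; then
  \<open>k\<close> and \<open>Suc n - k\<close> are genuine ranks. Otherwise \<open>k = 0\<close>
  and both constraints are vacuous.\<close>

lemma CI_eq:
  assumes n: "n \<ge> 1" and \<alpha>: "0 < \<alpha>" "\<alpha> < 1"
  shows "CI n \<alpha> x = (if log 2 (2 / \<alpha>) \<le> real n
     then {order_stat n x (nat (\<lfloor>real n / 2\<rfloor> - c_crit n \<alpha>)) .. order_stat n x (nat (\<lceil>real n / 2\<rceil> + c_crit n \<alpha> + 1))}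
     else UNIV)"
proof -
  obtain c where c: "c_crit n \<alpha> = int c" "c \<le> n div 2"
    using c_crit[OF \<alpha>] by blast
  define k where "k = n div 2 - c"
  have fl: "\<lfloor>real n / 2\<rfloor> = int (n div 2)" "\<lceil>real n / 2\<rceil> = int n - int (n div 2)"
    by linarith+
  have k: "\<lfloor>real n / 2\<rfloor> - c_crit n \<alpha> = int k" "nat (\<lceil>real n / 2\<rceil> + c_crit n \<alpha> + 1) = Suc n - k"
    using c by (auto simp: fl k_def)
  have CI: "CI n \<alpha> x = {\<theta>. int k \<le> (\<Sum>i=1..n. of_bool (x i \<le> \<theta>))} \<inter> {\<theta>. int k \<le> (\<Sum>i=1..n. of_bool (\<theta> \<le> x i))}"
    unfolding CI_def CI1_def CI2_def k ..
  show ?thesis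
  proof (cases "log 2 (2 / \<alpha>) \<le> real n")
    case True
    then have "1 \<le> k" "k \<le> n" using log_le_iff_c_crit[OF n \<alpha>] c by (auto simp: k_def)
    then show ?thesis
      unfolding CI k nat_int count_le_iff_order_stat[OF \<open>1 \<le> k\<close> \<open>k \<le> n\<close>]
        count_ge_iff_order_stat[OF \<open>1 \<le> k\<close> \<open>k \<le> n\<close>]
      using True by auto
  next
    case False
    then have "k = 0" using log_le_iff_c_crit[OF n \<alpha>] c by (auto simp: k_def)
    then show ?thesis unfolding CI using False by (simp add: sum_nonneg)
  qed
qed

text \<open>Domination by the fair binomial gives each one-sided event probability at least 1 -
  \<alpha>/2; the events are dependent, so they are combined by the union bound.\<close>

lemma (in prob_space) CI_coverage:
  fixes X :: "nat \<Rightarrow> 'a \<Rightarrow> real"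
  assumes indep: "indep_vars (\<lambda>_. borel) X {1..n}"
    and le: "\<And>i. i \<in> {1..n} \<Longrightarrow> prob {\<omega> \<in> space M. X i \<omega> \<le> \<theta>} \<ge> 1/2"
    and ge: "\<And>i. i \<in> {1..n} \<Longrightarrow> prob {\<omega> \<in> space M. X i \<omega> \<ge> \<theta>} \<ge> 1/2"
    and \<alpha>: "0 < \<alpha>" "\<alpha> < 1"
  shows "1 - \<alpha> \<le> prob {\<omega> \<in> space M. \<theta> \<in> CI n \<alpha> (\<lambda>i. X i \<omega>)}"
proof -
  obtain c where c: "c_crit n \<alpha> = int c" "c \<le> n div 2" "btail n (upper_rank n + c) \<le> \<alpha> / 2"
    using c_crit[OF \<alpha>] by blast
  define k where "k = n div 2 - c"
  have k: "\<lfloor>real n / 2\<rfloor> - c_crit n \<alpha> = int k"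
    using c floor_divide_of_nat_eq[of n 2, where ?'a = real] by (simp add: k_def)
  have "upper_rank n + c = Suc n - k" "k \<le> n" using c by (auto simp: upper_rank_def k_def)
  then have tail: "1 - \<alpha> / 2 \<le> btail n k" using btail_reflect[of k n] c by simp
  define A where "A = {\<omega> \<in> space M. int k \<le> (\<Sum>i=1..n. of_bool (X i \<omega> \<in> {..\<theta>}))}"
  define B where "B = {\<omega> \<in> space M. int k \<le> (\<Sum>i=1..n. of_bool (X i \<omega> \<in> {\<theta>..}))}"
  have meas: "{\<omega> \<in> space M. int k \<le> (\<Sum>i=1..n. of_bool (X i \<omega> \<in> C))} \<in> events" if "C \<in> sets borel" for C
  proof -
    have "(\<lambda>\<omega>. \<Sum>i=1..n. of_bool (X i \<omega> \<in> C) :: real) \<in> borel_measurable M"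
      using indep that
      by (intro borel_measurable_sum measurable_compose[where f="X _" and g="\<lambda>x. of_bool (x \<in> C)"])
         (auto simp: indep_vars_def)
    then have "{\<omega> \<in> space M. real k \<le> (\<Sum>i=1..n. of_bool (X i \<omega> \<in> C))} \<in> events" by measurable
    also have "{\<omega> \<in> space M. real k \<le> (\<Sum>i=1..n. of_bool (X i \<omega> \<in> C))}
        = {\<omega> \<in> space M. int k \<le> (\<Sum>i=1..n. of_bool (X i \<omega> \<in> C))}"
      by (simp only: sum_of_bool_le_iff)
    finally show ?thesis .
  qed
  have AB: "A \<in> events" "B \<in> events" unfolding A_def B_def by (intro meas; simp)+
  have "btail n k \<le> prob A"
    unfolding A_def using le by (intro btail_le_prob_count[OF indep]) auto
  moreover have "btail n k \<le> prob B"
    unfolding B_def using ge by (intro btail_le_prob_count[OF indep]) auto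
  moreover have "prob A + prob B \<le> 1 + prob (A \<inter> B)"
  proof -
    have "prob (A \<union> B) = prob A + prob (B - A)"
      using AB by (subst finite_measure_Union[symmetric]) auto
    moreover have "prob (B - A) = prob B - prob (B \<inter> A)"
      using AB by (intro finite_measure_Diff')
    ultimately show ?thesis using prob_le_1[of "A \<union> B"] by (simp add: Int_commute)
  qed
  moreover have "{\<omega> \<in> space M. \<theta> \<in> CI n \<alpha> (\<lambda>i. X i \<omega>)} = A \<inter> B"
    unfolding CI_def CI1_def CI2_def k A_def B_def by auto
  ultimately show ?thesis using tail by simp
qed

theorem theorem1:
  fixes M :: "'a measure" and X :: "nat \<Rightarrow> 'a \<Rightarrow> real" and n :: nat and \<theta>\<^sub>0 :: real
  assumes "prob_space M"
    and "n \<ge> 1"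
    and "prob_space.indep_vars M (\<lambda>_. borel) X {1..n}"
    and "\<And>i. i \<in> {1..n} \<Longrightarrow> measure M {\<omega> \<in> space M. X i \<omega> \<le> \<theta>\<^sub>0} \<ge> 1/2"
    and "\<And>i. i \<in> {1..n} \<Longrightarrow> measure M {\<omega> \<in> space M. X i \<omega> \<ge> \<theta>\<^sub>0} \<ge> 1/2"
  shows "(\<forall>\<alpha>\<in>{0<..<1}.
            measure M {\<omega> \<in> space M. \<theta>\<^sub>0 \<in> CI n \<alpha> (\<lambda>i. X i \<omega>)} \<ge> 1 - \<alpha>) \<and>
         (\<forall>\<alpha>\<in>{0<..<1}. \<forall>\<omega>\<in>space M.
            CI n \<alpha> (\<lambda>i. X i \<omega>) =
              (if real n \<ge> log 2 (2 / \<alpha>)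
               then {order_stat n (\<lambda>i. X i \<omega>) (nat (\<lfloor>real n / 2\<rfloor> - c_crit n \<alpha>)) ..
                     order_stat n (\<lambda>i. X i \<omega>) (nat (\<lceil>real n / 2\<rceil> + c_crit n \<alpha> + 1))}
               else UNIV)) \<and>
         (\<forall>\<alpha>\<in>{0<..<1}.
            real_of_int (c_crit n \<alpha>) - sqrt (real n) * z_upper (\<alpha> / 2) / 2 \<in>
              (if real n \<ge> log 2 (2 / \<alpha>)
               then {- (1 / (2 * sqrt (real n))) *
                       max (z_upper (\<alpha> / 2) ^ 3 / 5) (sqrt (1 + (2 * ln 2 - 1) / (real n)\<^sup>2)) - 1.5 .. 1}
               else {real_of_int \<lfloor>real n / 2\<rfloor> - sqrt (real n) * z_upper (\<alpha> / 2) / 2}))"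
proof (intro conjI ballI)
  interpret prob_space M by (rule assms(1))
  fix \<alpha> :: real assume "\<alpha> \<in> {0<..<1}"
  then have \<alpha>: "0 < \<alpha>" "\<alpha> < 1" by auto
  show "1 - \<alpha> \<le> prob {\<omega> \<in> space M. \<theta>\<^sub>0 \<in> CI n \<alpha> (\<lambda>i. X i \<omega>)}"
    by (rule CI_coverage) (use assms \<alpha> in auto)
  show "CI n \<alpha> (\<lambda>i. X i \<omega>) =
      (if real n \<ge> log 2 (2 / \<alpha>)
       then {order_stat n (\<lambda>i. X i \<omega>) (nat (\<lfloor>real n / 2\<rfloor> - c_crit n \<alpha>)) ..
             order_stat n (\<lambda>i. X i \<omega>) (nat (\<lceil>real n / 2\<rceil> + c_crit n \<alpha> + 1))}
       else UNIV)" for \<omega>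
    by (rule CI_eq[OF assms(2) \<alpha>])
  define z where "z = z_upper (\<alpha> / 2)"
  define r where "r = sqrt (1 + (2 * ln 2 - 1) / (real n)\<^sup>2)"
  show "real_of_int (c_crit n \<alpha>) - sqrt (real n) * z_upper (\<alpha> / 2) / 2 \<in>
      (if real n \<ge> log 2 (2 / \<alpha>)
       then {- (1 / (2 * sqrt (real n))) *
               max (z_upper (\<alpha> / 2) ^ 3 / 5) (sqrt (1 + (2 * ln 2 - 1) / (real n)\<^sup>2)) - 1.5 .. 1}
       else {real_of_int \<lfloor>real n / 2\<rfloor> - sqrt (real n) * z_upper (\<alpha> / 2) / 2})"
  proof (cases "log 2 (2 / \<alpha>) \<le> real n")
    case True
    have "sqrt (real n) * z / 2 - z ^ 3 / (10 * sqrt (real n)) - 3 / 2 \<le> real_of_int (c_crit n \<alpha>)"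
      unfolding z_def using True log_le_iff_c_crit[OF assms(2) \<alpha>] by (intro le_c_crit \<alpha>) simp
    \<comment> \<open>The maximum enters with a negative sign, so it lowers the left
      endpoint.\<close>
    moreover have "1 / (2 * sqrt (real n)) * (z ^ 3 / 5) \<le> 1 / (2 * sqrt (real n)) * max (z ^ 3 / 5) r"
      by (intro mult_left_mono) auto
    moreover have "real_of_int (c_crit n \<alpha>) \<le> sqrt (real n) * z / 2 + 1"
      unfolding z_def by (rule c_crit_le[OF assms(2) \<alpha>])
    ultimately show ?thesis
      using True unfolding z_def[symmetric] r_def[symmetric] by simp
  next
    case False
    moreover have "c_crit n \<alpha> = \<lfloor>real n / 2\<rfloor>"
      using False log_le_iff_c_crit[OF assms(2) \<alpha>] c_crit[OF \<alpha>, of n]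
        floor_divide_of_nat_eq[of n 2, where ?'a = real] by auto
    ultimately show ?thesis by simp
  qed
qed

end
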